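(* Let $G$ be a compact Hausdorff abelian topological group which is torsion, or divisible, or torsion-free. Then the following conditions are equivalent: (1) $G$ is dense-subgroup-separable; (2) $G$ is dense-separable; (3) $\widehat{G}$ is countable, where $\widehat{G}$ is the dual group of $G$ endowed with the compact-open topology; (4) $G$ is topologically isomorphic to a subgroup of the torus $\mathbb{T}^{\aleph_{0}}$.
   Context: A topological group is dense-subgroup-separable if each of its dense subgroups is separable. A space is dense-separable if each of its dense subspaces is separable. $\mathbb{T}$ is the unit circle group with its usual topology, and the dual group $\widehat{G}$ consists of all continuous homomorphisms $G\to\mathbb{T}$. An abelian group $G$ (additive notation) is divisible if for all $g\in G$ and positive integers $n$ the equation $nx=g$ has a solution $x\in G$; torsion if each element has finite order; torsion-free if only the neutral element has finite order. *)

theory Defs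
  imports "HOL-Analysis.Analysis" "HOL-Algebra.Product_Groups"
begin

text \<open>
  A topological group is a group in the sense of HOL-Algebra together with an abstract topology
  on its carrier. Groups are written multiplicatively, following HOL-Algebra: \<open>n x\<close> in additive
  notation is \<open>x [^] n\<close> here.
\<close>

locale topological_group = group G for G (structure) +
  fixes T :: "'a topology"
  assumes topspace_eq: "topspace T = carrier G"
    and continuous_map_mult: "continuous_map (prod_topology T T) T (\<lambda>(x, y). x \<otimes> y)"
    and continuous_map_inv: "continuous_map T T (\<lambda>x. inv x)"

definition dense_in :: "'a topology \<Rightarrow> 'a set \<Rightarrow> bool" where
  "dense_in T S \<longleftrightarrow> S \<subseteq> topspace T \<and> T closure_of S = topspace T"

definition dense_separable :: "'a topology \<Rightarrow> bool" where
  "dense_separable T \<longleftrightarrow> (\<forall>S. dense_in T S \<longrightarrow> separable_space (subtopology T S))"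

definition dense_subgroup_separable :: "('a, 'b) monoid_scheme \<Rightarrow> 'a topology \<Rightarrow> bool" where
  "dense_subgroup_separable G T \<longleftrightarrow>
     (\<forall>H. subgroup H G \<and> dense_in T H \<longrightarrow> separable_space (subtopology T H))"

definition divisible_group :: "('a, 'b) monoid_scheme \<Rightarrow> bool" where
  "divisible_group G \<longleftrightarrow>
     (\<forall>g\<in>carrier G. \<forall>n::nat. n > 0 \<longrightarrow> (\<exists>x\<in>carrier G. x [^]\<^bsub>G\<^esub> n = g))"

definition has_finite_order :: "('a, 'b) monoid_scheme \<Rightarrow> 'a \<Rightarrow> bool" where
  "has_finite_order G x \<longleftrightarrow> (\<exists>n::nat. n > 0 \<and> x [^]\<^bsub>G\<^esub> n = \<one>\<^bsub>G\<^esub>)"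

definition torsion_group :: "('a, 'b) monoid_scheme \<Rightarrow> bool" where
  "torsion_group G \<longleftrightarrow> (\<forall>x\<in>carrier G. has_finite_order G x)"

definition torsion_free_group :: "('a, 'b) monoid_scheme \<Rightarrow> bool" where
  "torsion_free_group G \<longleftrightarrow> (\<forall>x\<in>carrier G. has_finite_order G x \<longrightarrow> x = \<one>\<^bsub>G\<^esub>)"

definition circle_group :: "complex monoid" where
  "circle_group = \<lparr>carrier = sphere 0 1, monoid.mult = (*), one = 1\<rparr>"

definition circle_topology :: "complex topology" where
  "circle_topology = top_of_set (sphere 0 1)"

definition torus_group :: "(nat \<Rightarrow> complex) monoid" where
  "torus_group = product_group UNIV (\<lambda>_. circle_group)"

definition torus_topology :: "(nat \<Rightarrow> complex) topology" where
  "torus_topology = product_topology (\<lambda>_. circle_topology) UNIV"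

definition topologically_isomorphic ::
    "('a, 'c) monoid_scheme \<Rightarrow> 'a topology \<Rightarrow> ('b, 'd) monoid_scheme \<Rightarrow> 'b topology \<Rightarrow> bool" where
  "topologically_isomorphic G T H Y \<longleftrightarrow> (\<exists>f. f \<in> iso G H \<and> homeomorphic_map T Y f)"

text \<open>
  A character is represented by a function that is \<open>undefined\<close> outside the carrier of \<open>G\<close>, so that
  characters which agree on \<open>G\<close> are equal; without this restriction the cardinality of the dual
  group would count irrelevant values outside of \<open>G\<close>.
\<close>

definition dual_group :: "('a, 'b) monoid_scheme \<Rightarrow> 'a topology \<Rightarrow> ('a \<Rightarrow> complex) monoid" where
  "dual_group G T =
     \<lparr>carrier = {\<alpha> \<in> extensional (carrier G).
                  \<alpha> \<in> hom G circle_group \<and> continuous_map T circle_topology \<alpha>},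
      monoid.mult = (\<lambda>\<alpha> \<beta>. \<lambda>x\<in>carrier G. \<alpha> x \<otimes>\<^bsub>circle_group\<^esub> \<beta> x),
      one = (\<lambda>x\<in>carrier G. \<one>\<^bsub>circle_group\<^esub>)\<rparr>"

text \<open>The compact-open topology on the dual group, given by its usual subbase.\<close>

definition dual_topology :: "('a, 'b) monoid_scheme \<Rightarrow> 'a topology \<Rightarrow> ('a \<Rightarrow> complex) topology" where
  "dual_topology G T = topology_generated_by
     {{\<alpha> \<in> carrier (dual_group G T). \<alpha> ` K \<subseteq> U} |K U. compactin T K \<and> openin circle_topology U}"

lemma topspace_dual_topology: "topspace (dual_topology G T) = carrier (dual_group G T)"
proof -
  have "carrier (dual_group G T) \<in>
      {{\<alpha> \<in> carrier (dual_group G T). \<alpha> ` K \<subseteq> U} |K U. compactin T K \<and> openin circle_topology U}"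
    by (rule CollectI, rule exI[of _ "{}"], rule exI[of _ "{}"]) simp
  then show ?thesis
    unfolding dual_topology_def topology_generated_by_topspace by blast
qed

lemma inverse_mult_circle: "norm (x::complex) = 1 \<Longrightarrow> inverse x * x = 1"
  by (rule left_inverse) auto

lemma comm_group_circle_group: "comm_group circle_group"
proof (rule comm_groupI)
  fix x assume "x \<in> carrier circle_group"
  then show "\<exists>y\<in>carrier circle_group. y \<otimes>\<^bsub>circle_group\<^esub> x = \<one>\<^bsub>circle_group\<^esub>"
    by (intro bexI[of _ "inverse x"]) (auto simp: circle_group_def norm_inverse inverse_mult_circle)
qed (auto simp: circle_group_def norm_mult)

lemma inv_circle_group:
  assumes "x \<in> carrier circle_group"
  shows "inv\<^bsub>circle_group\<^esub> x = inverse x"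
proof -
  interpret comm_group circle_group by (rule comm_group_circle_group)
  show ?thesis
    using assms by (intro inv_equality) (auto simp: circle_group_def norm_inverse inverse_mult_circle)
qed

lemma topological_group_circle: "topological_group circle_group circle_topology"
proof -
  interpret comm_group circle_group by (rule comm_group_circle_group)
  show ?thesis
  proof
    show "topspace circle_topology = carrier circle_group"
      by (simp add: circle_topology_def circle_group_def)
    have "continuous_on (sphere 0 1 \<times> sphere 0 1) (\<lambda>(x, y). x * y :: complex)"
      by (simp add: case_prod_unfold, intro continuous_intros)
    then show "continuous_map (prod_topology circle_topology circle_topology) circle_topology
          (\<lambda>(x, y). x \<otimes>\<^bsub>circle_group\<^esub> y)"
      by (auto simp: circle_topology_def circle_group_def norm_mult
            simp flip: subtopology_Times euclidean_product_topology)
    have "continuous_on (sphere 0 1) (inverse :: complex \<Rightarrow> complex)"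
      by (intro continuous_intros) auto
    then have "continuous_map circle_topology circle_topology inverse"
      by (auto simp: circle_topology_def norm_inverse)
    then show "continuous_map circle_topology circle_topology (\<lambda>x. inv\<^bsub>circle_group\<^esub> x)"
      by (rule continuous_map_eq)
         (simp add: inv_circle_group \<open>topspace circle_topology = carrier circle_group\<close>)
  qed
qed

end

theory Submission
  imports Defs "HOL-Algebra.FiniteProduct"
begin

text \<open>
  All four conditions amount to the countability of the dual group.

  If the dual is countable, evaluating all characters embeds the group into a countable power of the
  circle, because characters separate points. A subspace of that power is second countable, so all
  of its subspaces, dense or not, are separable; this covers dense separability and, as a special
  case, dense subgroup separability.

  It remains to find a dense nonseparable subgroup when the dual is uncountable. An uncountable
  abelian group contains an uncountable independent set \<open>I\<close> (\<open>uncountable_independent_set\<close>). In the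
  model case of a product of circles with the projections as \<open>I\<close>, the \<open>\<Sigma>\<close>-product of points with
  countable support is dense and not separable. The lemma \<open>not_dense_subgroup_separable\<close>
  does the same in general, with two facts of duality theory as input: a point outside the closure
  of a subgroup is separated from it by a character (\<open>separating_character\<close>), and a character that
  is trivial on the common kernel of a set of characters belongs to the group which that set
  generates (\<open>double_annihilator\<close>).

  Both facts are proved without Haar measure or spectral theory. For the first, let \<open>\<phi>\<close> be a
  continuous function on the group that separates \<open>g\<close> from the subgroup. By recurrence, a finitely
  generated subgroup of a compact group is approximated by finite abelian groups. There Parseval's
  identity, applied to an autocorrelation, produces a character whose correlation with
  \<open>\<phi> (g \<otimes> t) - \<phi> t\<close> is bounded below independently of the finite group. The corresponding Fourier
  components of \<open>\<phi>\<close> are uniformly equicontinuous approximate characters, and a cluster point of them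
  is, up to a scalar, a continuous character that is nontrivial at \<open>g\<close>. The second fact combines the
  Stone-Weierstrass theorem with the observation that suitable finite averages annihilate any given
  combination of nontrivial characters.
\<close>

section \<open>Independent subsets of abelian groups\<close>

text \<open>
  The family of cyclic subgroups generated by the members of \<open>I\<close> forms an internal direct sum. The
  formulation with disjoint subsets of \<open>I\<close> covers elements of finite and of infinite order alike,
  and it is the form in which independence is used to build a dense subgroup.
\<close>

definition independent_in :: "('a, 'b) monoid_scheme \<Rightarrow> 'a set \<Rightarrow> bool" where
  "independent_in G I \<longleftrightarrow> I \<subseteq> carrier G \<and> \<one>\<^bsub>G\<^esub> \<notin> I \<and>
     (\<forall>A B. A \<subseteq> I \<longrightarrow> B \<subseteq> I \<longrightarrow> A \<inter> B = {} \<longrightarrow> generate G A \<inter> generate G B \<subseteq> {\<one>\<^bsub>G\<^esub>})"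

lemma (in group) generate_finite_support:
  "x \<in> generate G S \<Longrightarrow> \<exists>F\<subseteq>S. finite F \<and> x \<in> generate G F"
proof (induction rule: generate.induct)
  case one
  then show ?case by (intro exI[of _ "{}"]) (auto intro: generate.one)
next
  case (incl h)
  then show ?case by (intro exI[of _ "{h}"]) (auto intro: generate.incl)
next
  case (inv h)
  then show ?case by (intro exI[of _ "{h}"]) (auto intro: generate.inv)
next
  case (eng h1 h2)
  then obtain F1 F2 where "F1 \<subseteq> S" "finite F1" "h1 \<in> generate G F1"
    "F2 \<subseteq> S" "finite F2" "h2 \<in> generate G F2" by blast
  then show ?case
    using mono_generate[of F1 "F1 \<union> F2"] mono_generate[of F2 "F1 \<union> F2"]
    by (intro exI[of _ "F1 \<union> F2"]) (auto intro: generate.eng)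
qed

lemma (in group) countable_generate:
  assumes "S \<subseteq> carrier G" "countable S"
  shows "countable (generate G S)"
proof -
  define L where "L = S \<union> (\<lambda>x. inv x) ` S"
  define e where "e = (\<lambda>xs. foldr (\<otimes>) xs \<one>)"
  have L: "L \<subseteq> carrier G" using assms by (auto simp: L_def)
  have e_closed: "e xs \<in> carrier G" if "xs \<in> lists L" for xs
    using that L by (induction xs) (auto simp: e_def)
  have e_append: "e (xs @ ys) = e xs \<otimes> e ys" if "xs \<in> lists L" "ys \<in> lists L" for xs ys
    using that(1)
  proof (induction xs)
    case Nil
    then show ?case using e_closed[OF that(2)] by (simp add: e_def)
  next
    case (Cons a xs)
    then have "a \<in> carrier G" using L by auto
    then show ?case using Cons e_closed[OF that(2)] e_closed[of xs]
      by (simp add: e_def m_assoc)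
  qed
  have "x \<in> e ` lists L" if "x \<in> generate G S" for x
    using that
  proof (induction rule: generate.induct)
    case one
    then show ?case by (intro image_eqI[of _ _ "[]"]) (auto simp: e_def)
  next
    case (incl h)
    then show ?case using assms by (intro image_eqI[of _ _ "[h]"]) (auto simp: e_def L_def)
  next
    case (inv h)
    then show ?case using assms by (intro image_eqI[of _ _ "[inv h]"]) (auto simp: e_def L_def)
  next
    case (eng h1 h2)
    then obtain xs ys where "xs \<in> lists L" "h1 = e xs" "ys \<in> lists L" "h2 = e ys" by blast
    then show ?case by (intro image_eqI[of _ _ "xs @ ys"]) (auto simp: e_append)
  qed
  moreover have "countable (e ` lists L)"
    using assms by (simp add: L_def)
  ultimately show ?thesis by (meson countable_subset subsetI)
qed

lemma (in comm_group) generate_insert_decompose: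
  assumes "A \<subseteq> carrier G" "x \<in> carrier G" "y \<in> generate G (insert x A)"
  shows "\<exists>a\<in>generate G A. \<exists>k::int. y = a \<otimes> x [^] k"
  using assms(3)
proof (induction rule: generate.induct)
  case one
  then show ?case by (intro bexI[of _ \<one>] exI[of _ 0]) (auto intro: generate.one)
next
  case (incl h)
  then consider "h = x" | "h \<in> A" by blast
  then show ?case
  proof cases
    case 1
    then show ?thesis using assms
      by (intro bexI[of _ \<one>] exI[of _ 1]) (auto intro: generate.one simp: int_pow_1)
  next
    case 2
    then show ?thesis using assms
      by (intro bexI[of _ h] exI[of _ 0]) (auto intro: generate.incl)
  qed
next
  case (inv h)
  then consider "h = x" | "h \<in> A" by blast
  then show ?case
  proof cases
    case 1
    then show ?thesis using assms
      by (intro bexI[of _ \<one>] exI[of _ "-1"]) (auto intro: generate.one simp: int_pow_neg int_pow_1)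
  next
    case 2
    then show ?thesis using assms
      by (intro bexI[of _ "inv h"] exI[of _ 0]) (auto intro: generate.inv)
  qed
next
  case (eng h1 h2)
  then obtain a1 a2 and k1 k2 :: int where h: "a1 \<in> generate G A" "h1 = a1 \<otimes> x [^] k1"
    "a2 \<in> generate G A" "h2 = a2 \<otimes> x [^] k2" by blast
  have c: "a1 \<in> carrier G" "a2 \<in> carrier G"
    using h generate_in_carrier assms by blast+
  have "h1 \<otimes> h2 = (a1 \<otimes> a2) \<otimes> x [^] (k1 + k2)"
    using c assms h by (simp add: int_pow_mult m_ac)
  then show ?case using h by (blast intro: generate.eng)
qed

text \<open>
  Independence is of finite character, because membership in a generated subgroup is: this is the
  hypothesis of Zorn's lemma.
\<close>

lemma (in group) independent_in_Union_chain:
  assumes "subset.chain {I. independent_in G I} C"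
  shows "independent_in G (\<Union>C)"
proof (cases "C = {}")
  case True
  then show ?thesis
    by (auto simp: independent_in_def generate_empty)
next
  case False
  have ind: "independent_in G I" if "I \<in> C" for I
    using assms that by (auto simp: subset.chain_def)
  have "generate G A \<inter> generate G B \<subseteq> {\<one>}"
    if AB: "A \<subseteq> \<Union>C" "B \<subseteq> \<Union>C" "A \<inter> B = {}" for A B
  proof
    fix y assume "y \<in> generate G A \<inter> generate G B"
    then obtain F E where F: "F \<subseteq> A" "finite F" "y \<in> generate G F"
      and E: "E \<subseteq> B" "finite E" "y \<in> generate G E"
      using generate_finite_support by (meson IntD1 IntD2)
    have "finite (F \<union> E)" "F \<union> E \<subseteq> \<Union>C" using F E AB by auto
    then obtain I where I: "I \<in> C" "F \<union> E \<subseteq> I"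
      by (rule finite_subset_Union_chain[OF _ _ False assms])
    have "F \<inter> E = {}" using F E AB by blast
    then have "generate G F \<inter> generate G E \<subseteq> {\<one>}"
      using ind[OF I(1)] I(2) by (simp add: independent_in_def)
    then show "y \<in> {\<one>}" using F E by blast
  qed
  moreover have "I \<subseteq> carrier G \<and> \<one> \<notin> I" if "I \<in> C" for I
    using ind[OF that] by (simp add: independent_in_def)
  then have "\<Union>C \<subseteq> carrier G" "\<one> \<notin> \<Union>C" by blast+
  ultimately show ?thesis by (simp add: independent_in_def)
qed

text \<open>
  If a power of \<open>x\<close> times an element of \<open>\<langle>A\<rangle>\<close> equals an element of \<open>\<langle>B\<rangle>\<close>, then that power of \<open>x\<close> lies
  in \<open>\<langle>I\<rangle>\<close>, hence is trivial, and the equation lives in \<open>I\<close> alone.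
\<close>

lemma (in comm_group) independent_in_insert:
  assumes I: "independent_in G I" and x: "x \<in> carrier G" "x \<noteq> \<one>"
    and disj: "\<And>k::int. x [^] k \<in> generate G I \<Longrightarrow> x [^] k = \<one>"
  shows "independent_in G (insert x I)"
proof -
  have Ic: "I \<subseteq> carrier G" using I by (simp add: independent_in_def)
  have xI: "x \<notin> I"
  proof
    assume "x \<in> I"
    then show False using disj[of 1] x by (simp add: int_pow_1 generate.incl)
  qed
  have main: "y = \<one>"
    if A: "A \<subseteq> I" and B: "B \<subseteq> I" and AB: "A \<inter> B = {}"
      and y: "y \<in> generate G (insert x A)" "y \<in> generate G B" for A B y
  proof -
    obtain a and k :: int where a: "a \<in> generate G A" "y = a \<otimes> x [^] k"
      using generate_insert_decompose[OF _ x(1) y(1)] A Ic by blast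
    have cA: "a \<in> carrier G" and cy: "y \<in> carrier G"
      using a y generate_in_carrier A B Ic by (meson subset_trans)+
    have "x [^] k = inv a \<otimes> y"
      using a(2) cA cy x by (simp add: inv_solve_left)
    moreover have "inv a \<otimes> y \<in> generate G I"
      using mono_generate[OF A] mono_generate[OF B] a(1) y(2)
      by (intro generate.eng generate_m_inv_closed[OF Ic]) auto
    ultimately have "x [^] k = \<one>" using disj by metis
    then have "y \<in> generate G A" using a cA by simp
    moreover have "generate G A \<inter> generate G B \<subseteq> {\<one>}"
      using I A B AB by (simp add: independent_in_def)
    ultimately show "y = \<one>" using y(2) by blast
  qed
  have "generate G A \<inter> generate G B \<subseteq> {\<one>}"
    if A: "A \<subseteq> insert x I" and B: "B \<subseteq> insert x I" and AB: "A \<inter> B = {}" for A B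
  proof -
    have one_side: "generate G A \<inter> generate G B \<subseteq> {\<one>}"
      if "x \<in> A" "A \<subseteq> insert x I" "B \<subseteq> insert x I" "A \<inter> B = {}" for A B
    proof
      fix y assume y: "y \<in> generate G A \<inter> generate G B"
      have "A - {x} \<subseteq> I" "B \<subseteq> I" "(A - {x}) \<inter> B = {}" "insert x (A - {x}) = A"
        using that by auto
      then show "y \<in> {\<one>}" using main[of "A - {x}" B y] y by simp
    qed
    consider "x \<in> A" | "x \<in> B" | "x \<notin> A" "x \<notin> B" by blast
    then show ?thesis
    proof cases
      case 1
      then show ?thesis using one_side A B AB by blast
    next
      case 2
      then show ?thesis using one_side[OF 2 B A] AB by (simp add: Int_commute)
    next
      case 3
      then have "A \<subseteq> I" "B \<subseteq> I" using A B by auto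
      then show ?thesis using I AB by (simp add: independent_in_def)
    qed
  qed
  moreover have "insert x I \<subseteq> carrier G" "\<one> \<notin> insert x I"
    using I x by (auto simp: independent_in_def)
  ultimately show ?thesis by (simp add: independent_in_def)
qed

text \<open>
  The \<open>n\<close>-th roots of an element, if there are any, form a coset of the \<open>n\<close>-torsion subgroup.
\<close>

lemma (in comm_group) countable_roots_if_countable_torsion:
  assumes "countable {x \<in> carrier G. x [^] (n::nat) = \<one>}"
  shows "countable {x \<in> carrier G. x [^] n = y}"
proof (cases "\<exists>z\<in>carrier G. z [^] n = y")
  case True
  then obtain z where z: "z \<in> carrier G" "z [^] n = y" by blast
  have "{x \<in> carrier G. x [^] n = y} \<subseteq> (\<lambda>t. z \<otimes> t) ` {x \<in> carrier G. x [^] n = \<one>}"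
  proof
    fix x assume "x \<in> {x \<in> carrier G. x [^] n = y}"
    then have x: "x \<in> carrier G" "x [^] n = y" by auto
    have "(inv z \<otimes> x) [^] n = \<one>"
      using x(1) z(1) x(2)[folded z(2)] by (simp add: nat_pow_distrib nat_pow_inv)
    moreover have "x = z \<otimes> (inv z \<otimes> x)"
      using x z by (simp add: m_assoc[symmetric])
    ultimately show "x \<in> (\<lambda>t. z \<otimes> t) ` {x \<in> carrier G. x [^] n = \<one>}"
      using x z by blast
  qed
  then show ?thesis using assms by (meson countable_image countable_subset)
next
  case False
  then have "{x \<in> carrier G. x [^] n = y} = {}" by blast
  then show ?thesis by (metis countable_empty)
qed

text \<open>
  An essential extension of a countable abelian group is countable. Elements of prime order lie in
  the essential subgroup \<open>D\<close>, since every nontrivial power of such an element generates the same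
  cyclic group. Dividing by one prime at a time, each \<open>n\<close>-torsion subgroup is countable; and every
  element is an \<open>n\<close>-th root, for some \<open>n\<close>, of an element of \<open>D\<close>.
\<close>

lemma (in comm_group) countable_if_essential_countable_subgroup:
  assumes D: "subgroup D G" "countable D"
    and ess: "\<And>x. x \<in> carrier G \<Longrightarrow> x \<noteq> \<one> \<Longrightarrow> \<exists>k::int. x [^] k \<in> D \<and> x [^] k \<noteq> \<one>"
  shows "countable (carrier G)"
proof -
  have prime_torsion: "{x \<in> carrier G. x [^] p = \<one>} \<subseteq> D" if p: "prime p" for p :: nat
  proof
    fix x assume "x \<in> {x \<in> carrier G. x [^] p = \<one>}"
    then have x: "x \<in> carrier G" "x [^] p = \<one>" by auto
    show "x \<in> D"
    proof (cases "x = \<one>")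
      case True
      then show ?thesis using D by (simp add: subgroup.one_closed)
    next
      case False
      then obtain k :: int where k: "x [^] k \<in> D" "x [^] k \<noteq> \<one>" using ess x by blast
      have xp: "x [^] int p = \<one>" using x by (simp add: int_pow_int)
      have "\<not> int p dvd k"
      proof
        assume "int p dvd k"
        then obtain j where "k = int p * j" by blast
        then have "x [^] k = \<one>" using xp x by (simp add: int_pow_pow[symmetric])
        then show False using k by blast
      qed
      then have "coprime (int p) k" using p by (simp add: prime_imp_coprime)
      then obtain u v where uv: "u * int p + v * k = 1"
        by (metis bezout_int coprime_iff_gcd_eq_1)
      have "x = x [^] (u * int p + v * k)" using uv x by (simp add: int_pow_1)
      also have "\<dots> = (x [^] int p) [^] u \<otimes> (x [^] k) [^] v"
        using x by (simp add: int_pow_mult int_pow_pow mult.commute)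
      also have "\<dots> = (x [^] k) [^] v" using xp x by simp
      finally have eq: "x = (x [^] k) [^] v" .
      have "(x [^] k) [^] v \<in> D" by (rule subgroup_int_pow_closed[OF D(1) k(1)])
      then show ?thesis by (subst eq)
    qed
  qed
  have torsion: "countable {x \<in> carrier G. x [^] n = \<one>}" if "n > 0" for n :: nat
    using that
  proof (induction n rule: less_induct)
    case (less n)
    show ?case
    proof (cases "n = 1")
      case True
      then have "{x \<in> carrier G. x [^] n = \<one>} = {\<one>}" by auto
      then show ?thesis by simp
    next
      case False
      then obtain p where p: "prime p" "p dvd n" using prime_factor_nat by blast
      then obtain m where m: "n = p * m" by blast
      have "m > 0" "m < n" using less.prems m prime_gt_1_nat[OF p(1)] by auto
      then have cm: "countable {x \<in> carrier G. x [^] m = \<one>}" using less.IH by blast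
      have cp: "countable {x \<in> carrier G. x [^] p = y}" for y
        by (rule countable_roots_if_countable_torsion[OF
            countable_subset[OF prime_torsion[OF p(1)] D(2)]])
      have "{x \<in> carrier G. x [^] n = \<one>} \<subseteq>
          (\<Union>y\<in>{y \<in> carrier G. y [^] m = \<one>}. {x \<in> carrier G. x [^] p = y})"
        using m by (auto simp: nat_pow_pow)
      then show ?thesis using cm cp by (meson countable_UN countable_subset)
    qed
  qed
  have "carrier G \<subseteq> insert \<one> (\<Union>n\<in>{0<..}. \<Union>y\<in>D. {x \<in> carrier G. x [^] (n::nat) = y})"
  proof
    fix x assume x: "x \<in> carrier G"
    show "x \<in> insert \<one> (\<Union>n\<in>{0<..}. \<Union>y\<in>D. {x \<in> carrier G. x [^] (n::nat) = y})"
    proof (cases "x = \<one>")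
      case False
      then obtain k :: int where k: "x [^] k \<in> D" "x [^] k \<noteq> \<one>" using ess x by blast
      then have "k \<noteq> 0" by (metis int_pow_0)
      have "x [^] nat \<bar>k\<bar> \<in> D"
      proof (cases "k \<ge> 0")
        case True
        then show ?thesis using k x by (simp add: pow_nat)
      next
        case False
        then have "x [^] nat \<bar>k\<bar> = inv (x [^] k)"
          using x by (simp add: int_pow_neg[symmetric] pow_nat)
        then show ?thesis using k D by (simp add: subgroup.m_inv_closed)
      qed
      then have "x \<in> (\<Union>n\<in>{0<..}. \<Union>y\<in>D. {x \<in> carrier G. x [^] (n::nat) = y})"
        using x \<open>k \<noteq> 0\<close> by (intro UN_I[of "nat \<bar>k\<bar>"] UN_I[of "x [^] nat \<bar>k\<bar>"]) auto
      then show ?thesis by blast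
    qed simp
  qed
  moreover have "countable (insert \<one> (\<Union>n\<in>{0<..}. \<Union>y\<in>D. {x \<in> carrier G. x [^] (n::nat) = y}))"
  proof (intro countable_insert countable_UN)
    fix n y assume "n \<in> {0::nat<..}" "y \<in> D"
    then show "countable {x \<in> carrier G. x [^] n = y}"
      using countable_roots_if_countable_torsion[OF torsion] by simp
  qed (use D(2) in auto)
  ultimately show ?thesis by (rule countable_subset)
qed

text \<open>
  A maximal independent set generates an essential subgroup, so it cannot be countable.
\<close>

lemma (in comm_group) uncountable_independent_set:
  assumes "uncountable (carrier G)"
  obtains I where "independent_in G I" "uncountable I"
proof -
  obtain I where I: "independent_in G I"
    and max: "\<And>J. independent_in G J \<Longrightarrow> I \<subseteq> J \<Longrightarrow> J = I"
    using subset_Zorn'[of "{I. independent_in G I}"] independent_in_Union_chain by auto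
  have Ic: "I \<subseteq> carrier G" using I by (simp add: independent_in_def)
  have "uncountable I"
  proof
    assume "countable I"
    then have "countable (generate G I)" using countable_generate Ic by blast
    moreover have "\<exists>k::int. x [^] k \<in> generate G I \<and> x [^] k \<noteq> \<one>"
      if x: "x \<in> carrier G" "x \<noteq> \<one>" for x
    proof (rule ccontr)
      assume neg: "\<not> ?thesis"
      then have "x \<in> I" using max[OF independent_in_insert[OF I x]] by blast
      then show False using neg x by (metis generate.incl int_pow_1)
    qed
    ultimately have "countable (carrier G)"
      using countable_if_essential_countable_subgroup generate_is_subgroup[OF Ic] by blast
    then show False using assms by blast
  qed
  then show ?thesis using that I by blast
qed

section \<open>Fourier analysis on finite abelian groups\<close>

text \<open>
  The orthogonality relation is the one in which the sum runs over the characters at a fixed point of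
  the group. Parseval's identity follows from it alone, and for products of cyclic groups it reduces
  to geometric sums, so the structure theory of finite abelian groups can be avoided.
\<close>

locale finite_fourier = comm_group B for B :: "('b, 'm) monoid_scheme" (structure) +
  fixes K :: "'k set" and e :: "'k \<Rightarrow> 'b \<Rightarrow> complex"
  assumes finite_carrier: "finite (carrier B)" and finite_K: "finite K"
    and e_mult: "\<And>k x y. k \<in> K \<Longrightarrow> x \<in> carrier B \<Longrightarrow> y \<in> carrier B \<Longrightarrow> e k (x \<otimes> y) = e k x * e k y"
    and norm_e: "\<And>k x. k \<in> K \<Longrightarrow> x \<in> carrier B \<Longrightarrow> norm (e k x) = 1"
    and orthogonality: "\<And>x. x \<in> carrier B \<Longrightarrow>
      (\<Sum>k\<in>K. e k x) = (if x = \<one> then of_nat (card (carrier B)) else 0)"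
begin

definition coeff :: "('b \<Rightarrow> complex) \<Rightarrow> 'k \<Rightarrow> complex" where
  "coeff f k = (\<Sum>x\<in>carrier B. f x * cnj (e k x))"

definition autocorrelation :: "('b \<Rightarrow> complex) \<Rightarrow> 'b \<Rightarrow> complex" where
  "autocorrelation f x = (\<Sum>y\<in>carrier B. f (x \<otimes> y) * cnj (f y))"

lemma card_carrier_pos: "card (carrier B) > 0"
  using finite_carrier by (auto simp: card_gt_0_iff)

lemma cnj_e_cancel: "k \<in> K \<Longrightarrow> x \<in> carrier B \<Longrightarrow> cnj (e k x) * e k x = 1"
  using norm_e[of k x] by (metis complex_cnj_mult complex_norm_square mult.commute of_real_1 one_power2)

lemma cnj_e_times_e:
  assumes "k \<in> K" "x \<in> carrier B" "y \<in> carrier B"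
  shows "cnj (e k x) * e k y = e k (inv x \<otimes> y)"
proof -
  have "e k y = e k x * e k (inv x \<otimes> y)"
    using assms by (simp add: e_mult[symmetric] m_assoc[symmetric])
  then show ?thesis using cnj_e_cancel[OF assms(1,2)] by (simp add: mult.assoc[symmetric])
qed

lemma bij_mult_right: "y \<in> carrier B \<Longrightarrow> bij_betw (\<lambda>x. x \<otimes> y) (carrier B) (carrier B)"
  by (rule bij_betw_byWitness[where f' = "\<lambda>x. x \<otimes> inv y"]) (auto simp: m_assoc)

lemma parseval:
  "(\<Sum>k\<in>K. (cmod (coeff f k))\<^sup>2) = card (carrier B) * (\<Sum>x\<in>carrier B. (cmod (f x))\<^sup>2)"
proof -
  have "(\<Sum>k\<in>K. coeff f k * cnj (coeff f k)) =
      (\<Sum>k\<in>K. \<Sum>x\<in>carrier B. \<Sum>y\<in>carrier B. f x * cnj (f y) * (cnj (e k x) * e k y))"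
    by (simp add: coeff_def sum_product mult_ac)
  also have "\<dots> = (\<Sum>k\<in>K. \<Sum>x\<in>carrier B. \<Sum>y\<in>carrier B. f x * cnj (f y) * e k (inv x \<otimes> y))"
    by (intro sum.cong refl) (simp add: cnj_e_times_e)
  also have "\<dots> = (\<Sum>x\<in>carrier B. \<Sum>y\<in>carrier B. \<Sum>k\<in>K. f x * cnj (f y) * e k (inv x \<otimes> y))"
    by (subst sum.swap, intro sum.cong refl, subst sum.swap) simp
  also have "\<dots> = (\<Sum>x\<in>carrier B. \<Sum>y\<in>carrier B.
      if y = x then f x * cnj (f y) * of_nat (card (carrier B)) else 0)"
  proof (intro sum.cong refl)
    fix x y assume xy: "x \<in> carrier B" "y \<in> carrier B"
    have iff: "inv x \<otimes> y = \<one> \<longleftrightarrow> y = x" using xy by (metis inv_closed inv_solve_left l_one r_inv r_one one_closed l_inv)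
    have "(\<Sum>k\<in>K. f x * cnj (f y) * e k (inv x \<otimes> y)) = f x * cnj (f y) * (\<Sum>k\<in>K. e k (inv x \<otimes> y))"
      by (simp add: sum_distrib_left)
    also have "(\<Sum>k\<in>K. e k (inv x \<otimes> y)) = (if y = x then of_nat (card (carrier B)) else 0)"
      using orthogonality[of "inv x \<otimes> y"] xy iff by simp
    finally show "(\<Sum>k\<in>K. f x * cnj (f y) * e k (inv x \<otimes> y)) =
       (if y = x then f x * cnj (f y) * of_nat (card (carrier B)) else 0)" by simp
  qed
  also have "\<dots> = (\<Sum>x\<in>carrier B. f x * cnj (f x) * of_nat (card (carrier B)))"
    using finite_carrier by (intro sum.cong refl) (simp add: sum.delta)
  also have "\<dots> = of_nat (card (carrier B)) * (\<Sum>x\<in>carrier B. f x * cnj (f x))"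
    by (simp add: sum_distrib_left mult_ac)
  finally have "complex_of_real (\<Sum>k\<in>K. (cmod (coeff f k))\<^sup>2) =
      complex_of_real (card (carrier B) * (\<Sum>x\<in>carrier B. (cmod (f x))\<^sup>2))"
    by (simp only: of_real_sum of_real_mult complex_norm_square of_real_of_nat_eq)
  then show ?thesis by (simp only: of_real_eq_iff)
qed

text \<open>
  Autocorrelation is convolution with the reflected conjugate, and the Fourier transform turns
  convolution into multiplication.
\<close>

lemma coeff_autocorrelation:
  assumes "k \<in> K"
  shows "coeff (autocorrelation f) k = coeff f k * cnj (coeff f k)"
proof -
  have "coeff (autocorrelation f) k =
      (\<Sum>y\<in>carrier B. \<Sum>x\<in>carrier B. f (x \<otimes> y) * cnj (f y) * cnj (e k x))"
    unfolding coeff_def autocorrelation_def by (simp add: sum_distrib_right) (rule sum.swap)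
  also have "\<dots> = (\<Sum>y\<in>carrier B. \<Sum>x\<in>carrier B.
      f (x \<otimes> y) * cnj (e k (x \<otimes> y)) * (cnj (f y) * e k y))"
  proof (intro sum.cong refl)
    fix x y assume xy: "x \<in> carrier B" "y \<in> carrier B"
    have "cnj (e k (x \<otimes> y)) * e k y = cnj (e k x) * (cnj (e k y) * e k y)"
      using e_mult[OF assms xy] by (simp add: mult_ac)
    then have "cnj (e k (x \<otimes> y)) * e k y = cnj (e k x)"
      using cnj_e_cancel[OF assms xy(2)] by simp
    then show "f (x \<otimes> y) * cnj (f y) * cnj (e k x) =
        f (x \<otimes> y) * cnj (e k (x \<otimes> y)) * (cnj (f y) * e k y)"
      by (simp add: mult_ac)
  qed
  also have "\<dots> = (\<Sum>y\<in>carrier B. coeff f k * (cnj (f y) * e k y))"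
  proof (intro sum.cong refl)
    fix y assume y: "y \<in> carrier B"
    have "(\<Sum>x\<in>carrier B. f (x \<otimes> y) * cnj (e k (x \<otimes> y))) = coeff f k"
      unfolding coeff_def by (rule sum.reindex_bij_betw[OF bij_mult_right[OF y]])
    then show "(\<Sum>x\<in>carrier B. f (x \<otimes> y) * cnj (e k (x \<otimes> y)) * (cnj (f y) * e k y)) =
        coeff f k * (cnj (f y) * e k y)"
      by (simp add: sum_distrib_right[symmetric])
  qed
  also have "\<dots> = coeff f k * cnj (coeff f k)"
    by (simp add: coeff_def sum_distrib_left)
  finally show ?thesis .
qed

text \<open>
  Parseval for the autocorrelation gives the sum of \<open>\<bar>coeff f k\<bar>\<^sup>4\<close>, which is at most the largest
  \<open>\<bar>coeff f k\<bar>\<^sup>2\<close> times the sum of \<open>\<bar>coeff f k\<bar>\<^sup>2\<close>; the latter is given by Parseval for \<open>f\<close>. The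
  point is that the resulting bound contains no factor that depends on the number of characters.
\<close>

lemma large_coeff:
  obtains k where "k \<in> K"
    "(\<Sum>x\<in>carrier B. (cmod (autocorrelation f x))\<^sup>2) \<le>
       (cmod (coeff f k))\<^sup>2 * (\<Sum>x\<in>carrier B. (cmod (f x))\<^sup>2)"
proof -
  have "K \<noteq> {}" using orthogonality[of \<one>] card_carrier_pos by auto
  then have M: "Max ((\<lambda>k. (cmod (coeff f k))\<^sup>2) ` K) \<in> (\<lambda>k. (cmod (coeff f k))\<^sup>2) ` K"
    using finite_K by (intro Max_in) auto
  then obtain k where k: "k \<in> K" "Max ((\<lambda>k. (cmod (coeff f k))\<^sup>2) ` K) = (cmod (coeff f k))\<^sup>2" by blast
  have max: "(cmod (coeff f j))\<^sup>2 \<le> (cmod (coeff f k))\<^sup>2" if "j \<in> K" for j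
    using that finite_K k(2)[symmetric] by simp
  have "card (carrier B) * (\<Sum>x\<in>carrier B. (cmod (autocorrelation f x))\<^sup>2) =
      (\<Sum>j\<in>K. (cmod (coeff f j))\<^sup>2 * (cmod (coeff f j))\<^sup>2)"
    unfolding parseval[symmetric]
    by (intro sum.cong refl) (simp add: coeff_autocorrelation norm_mult power2_eq_square)
  also have "\<dots> \<le> (\<Sum>j\<in>K. (cmod (coeff f k))\<^sup>2 * (cmod (coeff f j))\<^sup>2)"
    using max by (intro sum_mono mult_right_mono) auto
  also have "\<dots> = card (carrier B) * ((cmod (coeff f k))\<^sup>2 * (\<Sum>x\<in>carrier B. (cmod (f x))\<^sup>2))"
    unfolding sum_distrib_left[symmetric] parseval by simp
  finally show ?thesis using that[OF k(1)] card_carrier_pos by simp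
qed

end

lemma sum_cis_roots_of_unity:
  fixes m :: int
  assumes "N > 0" "0 \<le> m" "m < int N"
  shows "(\<Sum>k\<in>{0..<int N}. cis (2 * pi * of_int k * of_int m / real N)) = (if m = 0 then of_nat N else 0)"
proof -
  define z where "z = cis (2 * pi * of_int m / real N)"
  have "(\<Sum>k\<in>{0..<int N}. cis (2 * pi * of_int k * of_int m / real N)) = (\<Sum>k<N. z ^ k)"
  proof (rule sum.reindex_bij_witness[of _ int nat])
    fix k assume "k \<in> {0..<int N}"
    then show "z ^ nat k = cis (2 * pi * of_int k * of_int m / real N)"
      unfolding z_def Complex.DeMoivre by (simp add: mult_ac)
  qed auto
  also have "\<dots> = (if m = 0 then of_nat N else 0)"
  proof (cases "m = 0")
    case True
    then show ?thesis by (simp add: z_def)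
  next
    case False
    have "inj_on (\<lambda>k. cis (2 * pi * real k / real N)) {..<N}"
      using Complex.bij_betw_roots_unity[OF assms(1)] by (rule bij_betw_imp_inj_on)
    from inj_onD[OF this, of "nat m" 0] have "z \<noteq> 1"
      using False assms nat_less_iff[OF assms(2)] by (auto simp: z_def)
    moreover have "z ^ N = 1"
      using assms(1) unfolding z_def Complex.DeMoivre by (simp add: cis_multiple_2pi)
    ultimately show ?thesis using False by (simp add: geometric_sum)
  qed
  finally show ?thesis .
qed

lemma cis_mod:
  assumes "N > 0"
  shows "cis (2 * pi * of_int k * of_int (m mod int N) / real N) = cis (2 * pi * of_int k * of_int m / real N)"
proof -
  have "real_of_int m = real N * of_int (m div int N) + of_int (m mod int N)"
    by (metis mult_div_mod_eq of_int_add of_int_mult of_int_of_nat_eq)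
  then have "2 * pi * of_int k * of_int m / real N =
      2 * pi * of_int (k * (m div int N)) + 2 * pi * of_int k * of_int (m mod int N) / real N"
    using assms by (simp add: field_simps)
  then show ?thesis by (simp add: cis_mult[symmetric] cis_multiple_2pi)
qed

abbreviation cyclic_product :: "'a set \<Rightarrow> ('a \<Rightarrow> nat) \<Rightarrow> ('a \<Rightarrow> int) monoid" where
  "cyclic_product F N \<equiv> product_group F (\<lambda>a. integer_mod_group (N a))"

text \<open>
  The sum over all characters of a product of cyclic groups factorizes into sums of roots of unity.
\<close>

lemma finite_fourier_cyclic_product:
  assumes F: "finite F" and N: "\<And>a. a \<in> F \<Longrightarrow> N a > 0"
  shows "finite_fourier (cyclic_product F N) (carrier (cyclic_product F N))
    (\<lambda>k m. \<Prod>a\<in>F. cis (2 * pi * of_int (k a) * of_int (m a) / real (N a)))"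
proof -
  let ?B = "cyclic_product F N"
  let ?e = "\<lambda>k m. \<Prod>a\<in>F. cis (2 * pi * of_int (k a) * of_int (m a) / real (N a))"
  have car: "carrier ?B = (\<Pi>\<^sub>E a\<in>F. {0..<int (N a)})"
    unfolding carrier_product_group by (rule PiE_cong) (use N in \<open>simp add: carrier_integer_mod_group\<close>)
  interpret group ?B by simp
  have comm: "x \<otimes>\<^bsub>?B\<^esub> y = y \<otimes>\<^bsub>?B\<^esub> x" for x y
    by (simp add: add.commute)
  interpret comm_group ?B
    by (intro group_comm_groupI) (rule comm)
  show ?thesis
  proof
    show "finite (carrier ?B)" unfolding car using F by (intro finite_PiE) auto
    show "?e k (x \<otimes>\<^bsub>?B\<^esub> y) = ?e k x * ?e k y" for k x y
      unfolding prod.distrib[symmetric]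
    proof (rule prod.cong[OF refl])
      fix a assume "a \<in> F"
      then have "cis (2 * pi * of_int (k a) * of_int ((x \<otimes>\<^bsub>?B\<^esub> y) a) / real (N a)) =
          cis (2 * pi * of_int (k a) * of_int (x a + y a) / real (N a))"
        using cis_mod[OF N] by simp
      then show "cis (2 * pi * of_int (k a) * of_int ((x \<otimes>\<^bsub>?B\<^esub> y) a) / real (N a)) =
          cis (2 * pi * of_int (k a) * of_int (x a) / real (N a)) *
          cis (2 * pi * of_int (k a) * of_int (y a) / real (N a))"
        by (simp add: cis_mult ring_distribs add_divide_distrib)
    qed
    show "cmod (?e k x) = 1" for k x by (simp add: prod_norm[symmetric])
    show "(\<Sum>k\<in>carrier ?B. ?e k x) = (if x = \<one>\<^bsub>?B\<^esub> then of_nat (card (carrier ?B)) else 0)"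
      if x: "x \<in> carrier ?B" for x
    proof -
      have "(\<Sum>k\<in>carrier ?B. ?e k x) =
          (\<Prod>a\<in>F. \<Sum>k\<in>{0..<int (N a)}. cis (2 * pi * of_int k * of_int (x a) / real (N a)))"
        unfolding car using F by (subst prod_sum_PiE) auto
      also have "\<dots> = (\<Prod>a\<in>F. if x a = 0 then of_nat (N a) else 0)"
        using x N unfolding car by (intro prod.cong refl sum_cis_roots_of_unity) auto
      also have "\<dots> = (if x = \<one>\<^bsub>?B\<^esub> then of_nat (card (carrier ?B)) else 0)"
      proof (cases "x = \<one>\<^bsub>?B\<^esub>")
        case True
        then have "x a = 0" if "a \<in> F" for a using that by simp
        moreover have "card (carrier ?B) = (\<Prod>a\<in>F. N a)"
          unfolding car using F by (simp add: card_PiE)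
        ultimately show ?thesis using True by simp
      next
        case False
        have "x \<in> extensional F" using x by (simp add: PiE_iff)
        then obtain a where "a \<in> F" "x a \<noteq> 0"
          using False extensionalityI[of x F "\<one>\<^bsub>?B\<^esub>"] by auto
        then have "(\<Prod>a\<in>F. if x a = 0 then of_nat (N a) else 0 :: complex) = 0"
          using F by (auto intro!: prod_zero)
        then show ?thesis using False by simp
      qed
      finally show ?thesis .
    qed
  qed
qed

section \<open>Almost periodic functions and approximation by finite groups\<close>

definition almost_periods :: "('a, 'b) monoid_scheme \<Rightarrow> ('a \<Rightarrow> real) \<Rightarrow> real \<Rightarrow> 'a set" where
  "almost_periods G \<phi> \<eta> =
     {w \<in> carrier G. \<forall>x\<in>carrier G. \<bar>\<phi> (x \<otimes>\<^bsub>G\<^esub> w) - \<phi> x\<bar> \<le> \<eta>}"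

text \<open>
  The displacement \<open>sup\<^sub>x \<bar>\<phi> (x \<otimes> w) - \<phi> x\<bar>\<close> is the length of \<open>w\<close> for a translation invariant
  pseudometric on \<open>G\<close>, and the assumption says that \<open>G\<close> is totally bounded for it. These are the
  almost periodic functions of Bohr and von Neumann; continuous functions on compact groups are the
  example of interest.
\<close>

locale almost_periodic = comm_group G for G :: "('a, 'b) monoid_scheme" (structure) +
  fixes \<phi> :: "'a \<Rightarrow> real"
  assumes finite_net: "\<eta> > 0 \<Longrightarrow> \<exists>Z. finite Z \<and> Z \<subseteq> carrier G \<and>
      (\<forall>x\<in>carrier G. \<exists>b\<in>Z. x \<otimes> inv b \<in> almost_periods G \<phi> \<eta>)"
begin

abbreviation "AP \<equiv> almost_periods G \<phi>"

lemma diff_cancel_right: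
  assumes "x \<in> carrier G" "y \<in> carrier G" "b \<in> carrier G"
  shows "(x \<otimes> inv b) \<otimes> inv (y \<otimes> inv b) = x \<otimes> inv y"
proof -
  have "(x \<otimes> inv b) \<otimes> inv (y \<otimes> inv b) = x \<otimes> (inv b \<otimes> b) \<otimes> inv y"
    using assms by (simp only: inv_mult_group inv_inv m_assoc m_closed inv_closed)
  then show ?thesis using assms by simp
qed

lemma AP_carrier: "w \<in> AP \<eta> \<Longrightarrow> w \<in> carrier G"
  by (simp add: almost_periods_def)

lemma AP_D: "w \<in> AP \<eta> \<Longrightarrow> x \<in> carrier G \<Longrightarrow> \<bar>\<phi> (x \<otimes> w) - \<phi> x\<bar> \<le> \<eta>"
  by (simp add: almost_periods_def)

lemma AP_mono: "w \<in> AP \<eta> \<Longrightarrow> \<eta> \<le> \<eta>' \<Longrightarrow> w \<in> AP \<eta>'"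
  by (fastforce simp: almost_periods_def)

lemma AP_one: "0 \<le> \<eta> \<Longrightarrow> \<one> \<in> AP \<eta>"
  by (simp add: almost_periods_def)

lemma AP_mult:
  assumes "w \<in> AP \<eta>" "v \<in> AP \<eta>'"
  shows "w \<otimes> v \<in> AP (\<eta> + \<eta>')"
proof -
  have c: "w \<in> carrier G" "v \<in> carrier G" using assms by (simp_all add: AP_carrier)
  have "\<bar>\<phi> (x \<otimes> (w \<otimes> v)) - \<phi> x\<bar> \<le> \<eta> + \<eta>'" if x: "x \<in> carrier G" for x
    using AP_D[OF assms(1) x] AP_D[OF assms(2), of "x \<otimes> w"] x c by (simp add: m_assoc)
  then show ?thesis using c by (simp add: almost_periods_def)
qed

lemma AP_inv:
  assumes "w \<in> AP \<eta>"
  shows "inv w \<in> AP \<eta>"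
proof -
  have c: "w \<in> carrier G" using assms by (simp add: AP_carrier)
  have "\<bar>\<phi> (x \<otimes> inv w) - \<phi> x\<bar> \<le> \<eta>" if x: "x \<in> carrier G" for x
    using AP_D[OF assms, of "x \<otimes> inv w"] x c by (simp add: m_assoc abs_minus_commute)
  then show ?thesis using c by (simp add: almost_periods_def)
qed

lemma AP_finprod:
  assumes "finite F" "\<And>a. a \<in> F \<Longrightarrow> h a \<in> AP \<eta>"
  shows "finprod G h F \<in> AP (real (card F) * \<eta>)"
  using assms
proof (induction F rule: finite_induct)
  case empty
  then show ?case by (simp add: AP_one)
next
  case (insert a F)
  then have "h a \<otimes> finprod G h F \<in> AP (\<eta> + real (card F) * \<eta>)"
    by (intro AP_mult) auto
  moreover have "finprod G h (insert a F) = h a \<otimes> finprod G h F"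
    using insert AP_carrier by (intro finprod_insert) auto
  ultimately show ?case using insert by (simp add: algebra_simps)
qed

text \<open>
  Recurrence: among infinitely many powers of \<open>a\<close> two fall into the same cell of a finite net, and
  their quotient is an almost period. Only even powers are used, so that the exponent is at least
  \<open>2\<close> and the cyclic group of that order has a residue \<open>1\<close> different from \<open>0\<close>.
\<close>

lemma ex_power_in_AP:
  assumes a: "a \<in> carrier G" and "\<eta> > 0"
  obtains N :: nat where "N \<ge> 2" "a [^] N \<in> AP \<eta>"
proof -
  obtain Z where Z: "finite Z" "Z \<subseteq> carrier G"
    and net: "\<And>x. x \<in> carrier G \<Longrightarrow> \<exists>b\<in>Z. x \<otimes> inv b \<in> AP (\<eta> / 2)"
    using finite_net[of "\<eta> / 2"] assms(2) by auto
  have "\<forall>n::nat. \<exists>b. b \<in> Z \<and> a [^] (2 * n) \<otimes> inv b \<in> AP (\<eta> / 2)"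
    using net a by blast
  then obtain b where b: "\<And>n::nat. b n \<in> Z" "\<And>n. a [^] (2 * n) \<otimes> inv (b n) \<in> AP (\<eta> / 2)"
    by metis
  have "\<not> inj b"
    using Z(1) b(1) by (meson finite_imageD finite_subset image_subsetI infinite_UNIV_nat)
  then obtain i j where "b i = b j" "i \<noteq> j" by (auto simp: inj_def)
  then obtain m n where mn: "b m = b n" "m < n"
    by (metis linorder_neqE_nat)
  let ?p = "a [^] (2 * m)" and ?q = "a [^] (2 * n)"
  have bc: "b n \<in> carrier G" using b(1) Z(2) by blast
  have "(?q \<otimes> inv (b n)) \<otimes> inv (?p \<otimes> inv (b m)) \<in> AP (\<eta> / 2 + \<eta> / 2)"
    by (intro AP_mult AP_inv b(2))
  also have "(?q \<otimes> inv (b n)) \<otimes> inv (?p \<otimes> inv (b m)) = ?q \<otimes> inv ?p"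
    unfolding mn(1) using a bc by (intro diff_cancel_right) auto
  also have "?q = a [^] (2 * (n - m)) \<otimes> ?p"
    using a mn(2) by (simp add: nat_pow_mult diff_mult_distrib2)
  also have "\<dots> \<otimes> inv ?p = a [^] (2 * (n - m))"
    using a by (simp add: m_assoc)
  finally show ?thesis using that[of "2 * (n - m)"] mn(2) by simp
qed

text \<open>
  Up to almost periods, any finite set of elements of \<open>G\<close> lies in the image of a finite abelian
  group: replace the infinite cyclic group generated by \<open>a\<close> by a cyclic group of order \<open>N a\<close>, where
  \<open>a [^] N a\<close> is nearly a period. The map \<open>\<pi>\<close> multiplies up powers of the elements with exponents
  reduced modulo \<open>N a\<close>. It fails to be a homomorphism only through carries, and each carry
  contributes one factor \<open>a [^] N a\<close>.
\<close>

lemma cyclic_product_approximation: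
  assumes F: "finite F" "F \<subseteq> carrier G" and \<eta>: "\<eta> > 0"
  obtains N and \<pi> :: "('a \<Rightarrow> int) \<Rightarrow> 'a" where "\<And>a. a \<in> F \<Longrightarrow> N a > 0"
    "\<pi> \<in> carrier (cyclic_product F N) \<rightarrow> carrier G"
    "\<And>a. a \<in> F \<Longrightarrow> \<exists>m\<in>carrier (cyclic_product F N). \<pi> m = a"
    "\<And>m m'. m \<in> carrier (cyclic_product F N) \<Longrightarrow> m' \<in> carrier (cyclic_product F N) \<Longrightarrow>
       \<exists>w\<in>AP \<eta>. \<pi> m \<otimes> \<pi> m' = \<pi> (m \<otimes>\<^bsub>cyclic_product F N\<^esub> m') \<otimes> w"
proof -
  let ?\<eta> = "\<eta> / (card F + 1)"
  have "?\<eta> > 0" using \<eta> by simp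
  then have "\<exists>N::nat. N \<ge> 2 \<and> a [^] N \<in> AP ?\<eta>" if "a \<in> F" for a
    using ex_power_in_AP[of a ?\<eta>] that F(2) by blast
  then obtain N :: "'a \<Rightarrow> nat" where N: "\<And>a. a \<in> F \<Longrightarrow> N a \<ge> 2" "\<And>a. a \<in> F \<Longrightarrow> a [^] N a \<in> AP ?\<eta>"
    by metis
  let ?B = "cyclic_product F N"
  define \<pi> where "\<pi> = (\<lambda>m :: 'a \<Rightarrow> int. finprod G (\<lambda>a. a [^] m a) F)"
  have pow: "(\<lambda>a. a [^] (m a :: int)) \<in> F \<rightarrow> carrier G" for m using F(2) by auto
  have car: "m \<in> carrier ?B \<longleftrightarrow> m \<in> (\<Pi>\<^sub>E a\<in>F. {0..<int (N a)})" for m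
  proof -
    have "N a \<noteq> 0" if "a \<in> F" for a using N(1)[OF that] by simp
    then have "carrier ?B = (\<Pi>\<^sub>E a\<in>F. {0..<int (N a)})"
      unfolding carrier_product_group by (intro PiE_cong) (simp add: carrier_integer_mod_group)
    then show ?thesis by simp
  qed
  show thesis
  proof (rule that[of N \<pi>])
    show "N a > 0" if "a \<in> F" for a using N(1)[OF that] by simp
    show "\<pi> \<in> carrier ?B \<rightarrow> carrier G" unfolding \<pi>_def using pow by auto
    show "\<exists>m\<in>carrier ?B. \<pi> m = a" if a: "a \<in> F" for a
    proof
      define m :: "'a \<Rightarrow> int" where "m = (\<lambda>b\<in>F. if a = b then 1 else 0)"
      show "m \<in> carrier ?B" unfolding car m_def using N(1) by fastforce
      have "\<pi> m = finprod G (\<lambda>b. if a = b then b else \<one>) F"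
        unfolding \<pi>_def
        by (rule finprod_cong') (use F(2) in \<open>auto simp: m_def int_pow_1\<close>)
      also have "\<dots> = a" using finprod_singleton[OF a F(1), of "\<lambda>b. b"] F(2) by auto
      finally show "\<pi> m = a" .
    qed
    show "\<exists>w\<in>AP \<eta>. \<pi> m \<otimes> \<pi> m' = \<pi> (m \<otimes>\<^bsub>?B\<^esub> m') \<otimes> w"
      if m: "m \<in> carrier ?B" "m' \<in> carrier ?B" for m m'
    proof
      \<comment> \<open>The factor contributed by the carry in the coordinate belonging to \<open>a\<close>.\<close>
      define h where "h = (\<lambda>a. if m a + m' a < int (N a) then \<one> else a [^] N a)"
      have h_AP: "h a \<in> AP ?\<eta>" if "a \<in> F" for a
        using N(2)[OF that] \<eta> by (auto simp: h_def AP_one)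
      then have h_car: "h \<in> F \<rightarrow> carrier G" using AP_carrier by blast
      have "finprod G h F \<in> AP (real (card F) * ?\<eta>)" by (rule AP_finprod[OF F(1) h_AP])
      moreover have "real (card F) * ?\<eta> \<le> \<eta>" using \<eta> by (simp add: field_simps)
      ultimately show "finprod G h F \<in> AP \<eta>" by (rule AP_mono)
      have step: "a [^] m a \<otimes> a [^] m' a = a [^] ((m \<otimes>\<^bsub>?B\<^esub> m') a) \<otimes> h a" if a: "a \<in> F" for a
      proof -
        have ac: "a \<in> carrier G" using a F(2) by blast
        have b: "0 \<le> m a" "m a < int (N a)" "0 \<le> m' a" "m' a < int (N a)"
          using m a unfolding car by (auto simp: PiE_iff)
        have sum: "a [^] m a \<otimes> a [^] m' a = a [^] (m a + m' a)"
          by (rule int_pow_mult[OF ac, symmetric])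
        have v: "(m \<otimes>\<^bsub>?B\<^esub> m') a = (m a + m' a) mod int (N a)" using a by simp
        show ?thesis
        proof (cases "m a + m' a < int (N a)")
          case True
          then have "(m a + m' a) mod int (N a) = m a + m' a" using b by simp
          moreover have "h a = \<one>" using True by (simp only: h_def if_True)
          ultimately show ?thesis unfolding sum v using ac by simp
        next
          case False
          then have "(m a + m' a) mod int (N a) = m a + m' a - int (N a)"
            using b mod_pos_geq[of "int (N a)" "m a + m' a"]
              mod_pos_pos_trivial[of "m a + m' a - int (N a)" "int (N a)"] by linarith
          moreover have "h a = a [^] int (N a)" using False by (simp only: h_def if_False int_pow_int)
          ultimately show ?thesis unfolding sum v by (simp only: int_pow_mult[OF ac, symmetric]) simp
        qed
      qed
      have "\<pi> m \<otimes> \<pi> m' = finprod G (\<lambda>a. a [^] m a \<otimes> a [^] m' a) F"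
        unfolding \<pi>_def by (rule finprod_multf[symmetric]) (use pow in auto)
      also have "\<dots> = finprod G (\<lambda>a. a [^] ((m \<otimes>\<^bsub>?B\<^esub> m') a) \<otimes> h a) F"
        by (rule finprod_cong') (use step h_car subsetD[OF F(2)] in \<open>auto simp: Pi_iff simp del: mult_product_group\<close>)
      also have "\<dots> = \<pi> (m \<otimes>\<^bsub>?B\<^esub> m') \<otimes> finprod G h F"
        unfolding \<pi>_def by (rule finprod_multf) (use pow h_car in auto)
      finally show "\<pi> m \<otimes> \<pi> m' = \<pi> (m \<otimes>\<^bsub>?B\<^esub> m') \<otimes> finprod G h F" .
    qed
  qed
qed

text \<open>
  One of the cells of the net receives at least the fraction \<open>1 / card Z\<close> of the points of \<open>B\<close>.
  Quotients of points in that cell by a fixed one are distinct points of \<open>B\<close> that \<open>\<pi>\<close> maps to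
  almost periods. The tolerance \<open>\<theta>\<close> is split into three parts: two for the distances to the centre
  of the cell and one for the defect of \<open>\<pi>\<close>. The bound depends on the net only, not on \<open>B\<close>.
\<close>

lemma frequent_returns:
  fixes B :: "('c, 'd) monoid_scheme"
  assumes B: "group B" "finite (carrier B)" and \<pi>: "\<pi> \<in> carrier B \<rightarrow> carrier G"
    and err: "\<And>m m'. m \<in> carrier B \<Longrightarrow> m' \<in> carrier B \<Longrightarrow>
       \<exists>w\<in>AP (\<theta> / 3). \<pi> m \<otimes> \<pi> m' = \<pi> (m \<otimes>\<^bsub>B\<^esub> m') \<otimes> w"
    and Z: "finite Z" "Z \<subseteq> carrier G" "\<And>x. x \<in> carrier G \<Longrightarrow> \<exists>b\<in>Z. x \<otimes> inv b \<in> AP (\<theta> / 3)"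
  shows "card (carrier B) \<le> card Z * card {m \<in> carrier B. \<pi> m \<in> AP \<theta>}"
proof -
  interpret B: group B by (rule B(1))
  let ?S = "{m \<in> carrier B. \<pi> m \<in> AP \<theta>}"
  define C where "C = (\<lambda>b. {m \<in> carrier B. \<pi> m \<otimes> inv b \<in> AP (\<theta> / 3)})"
  have le: "card (C b) \<le> card ?S" if b: "b \<in> Z" for b
  proof (cases "C b = {}")
    case False
    then obtain m0 where m0: "m0 \<in> carrier B" "\<pi> m0 \<otimes> inv b \<in> AP (\<theta> / 3)" by (auto simp: C_def)
    have bc: "b \<in> carrier G" using b Z(2) by blast
    show ?thesis
    proof (rule card_inj_on_le)
      show "inj_on (\<lambda>m. m \<otimes>\<^bsub>B\<^esub> inv\<^bsub>B\<^esub> m0) (C b)"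
        using m0(1) by (auto simp: inj_on_def C_def)
      show "(\<lambda>m. m \<otimes>\<^bsub>B\<^esub> inv\<^bsub>B\<^esub> m0) ` C b \<subseteq> ?S"
      proof (safe)
        fix m assume "m \<in> C b"
        then have m: "m \<in> carrier B" "\<pi> m \<otimes> inv b \<in> AP (\<theta> / 3)" by (auto simp: C_def)
        let ?d = "m \<otimes>\<^bsub>B\<^esub> inv\<^bsub>B\<^esub> m0"
        show dc: "?d \<in> carrier B" using m m0 by simp
        obtain w where w: "w \<in> AP (\<theta> / 3)" "\<pi> ?d \<otimes> \<pi> m0 = \<pi> (?d \<otimes>\<^bsub>B\<^esub> m0) \<otimes> w"
          using err[OF dc m0(1)] by blast
        have "?d \<otimes>\<^bsub>B\<^esub> m0 = m" using m m0 by (simp add: B.m_assoc)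
        then have eq: "\<pi> ?d \<otimes> \<pi> m0 = \<pi> m \<otimes> w" using w(2) by simp
        have c: "\<pi> ?d \<in> carrier G" "\<pi> m0 \<in> carrier G" "\<pi> m \<in> carrier G" "w \<in> carrier G"
          using \<pi> dc m m0 w(1) AP_carrier by auto
        have "\<pi> ?d = (\<pi> m \<otimes> w) \<otimes> inv (\<pi> m0)"
          using eq c by (metis inv_solve_right m_closed)
        also have "\<dots> = (\<pi> m \<otimes> inv (\<pi> m0)) \<otimes> w" using c by (simp add: m_ac)
        also have "\<pi> m \<otimes> inv (\<pi> m0) = (\<pi> m \<otimes> inv b) \<otimes> inv (\<pi> m0 \<otimes> inv b)"
          using c bc by (simp add: diff_cancel_right)
        also have "(\<pi> m \<otimes> inv b) \<otimes> inv (\<pi> m0 \<otimes> inv b) \<otimes> w \<in> AP (\<theta> / 3 + \<theta> / 3 + \<theta> / 3)"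
          by (rule AP_mult[OF AP_mult[OF m(2) AP_inv[OF m0(2)]] w(1)])
        finally show "\<pi> ?d \<in> AP \<theta>" by simp
      qed
      show "finite ?S" using B(2) by simp
    qed
  qed simp
  have "carrier B = (\<Union>b\<in>Z. C b)"
    using Z(3) \<pi> by (auto simp: C_def Pi_iff)
  then have "card (carrier B) \<le> (\<Sum>b\<in>Z. card (C b))"
    using card_UN_le[OF Z(1), of C] by simp
  also have "\<dots> \<le> (\<Sum>b\<in>Z. card ?S)" by (intro sum_mono le)
  finally show ?thesis by simp
qed

text \<open>
  Averaging \<open>\<phi>\<close> over the image of \<open>B\<close> against a character of \<open>B\<close> yields an approximate eigenfunction
  of translation by \<open>\<pi> a\<close>: shift the summation variable by \<open>a\<close> and use that \<open>\<pi>\<close> is nearly a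
  homomorphism.
\<close>

lemma approximate_eigenfunction:
  fixes B :: "('c, 'd) monoid_scheme"
  assumes "finite_fourier B K e" and k: "k \<in> K" and \<pi>: "\<pi> \<in> carrier B \<rightarrow> carrier G"
    and err: "\<And>m m'. m \<in> carrier B \<Longrightarrow> m' \<in> carrier B \<Longrightarrow>
       \<exists>w\<in>AP \<epsilon>. \<pi> m \<otimes> \<pi> m' = \<pi> (m \<otimes>\<^bsub>B\<^esub> m') \<otimes> w"
    and \<Phi>: "\<And>x. \<Phi> x = (\<Sum>m\<in>carrier B. of_real (\<phi> (x \<otimes> \<pi> m)) * cnj (e k m)) / of_nat (card (carrier B))"
    and a: "a \<in> carrier B" and x: "x \<in> carrier G"
  shows "cmod (\<Phi> (x \<otimes> \<pi> a) - e k a * \<Phi> x) \<le> \<epsilon>"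
proof -
  interpret B: finite_fourier B K e by (rule assms(1))
  let ?n = "card (carrier B)"
  have n: "?n > 0" by (rule B.card_carrier_pos)
  have "e k a * (\<Sum>m\<in>carrier B. of_real (\<phi> (x \<otimes> \<pi> m)) * cnj (e k m)) =
      e k a * (\<Sum>m\<in>carrier B. of_real (\<phi> (x \<otimes> \<pi> (m \<otimes>\<^bsub>B\<^esub> a))) * cnj (e k (m \<otimes>\<^bsub>B\<^esub> a)))"
    using sum.reindex_bij_betw[OF B.bij_mult_right[OF a],
        of "\<lambda>m. of_real (\<phi> (x \<otimes> \<pi> m)) * cnj (e k m)"] by simp
  also have "\<dots> = (\<Sum>m\<in>carrier B. of_real (\<phi> (x \<otimes> \<pi> (m \<otimes>\<^bsub>B\<^esub> a))) * cnj (e k m))"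
    unfolding sum_distrib_left
  proof (intro sum.cong refl)
    fix m assume m: "m \<in> carrier B"
    have "e k a * cnj (e k (m \<otimes>\<^bsub>B\<^esub> a)) = cnj (e k m) * (cnj (e k a) * e k a)"
      using B.e_mult[OF k m a] by (simp add: mult_ac)
    then have "e k a * cnj (e k (m \<otimes>\<^bsub>B\<^esub> a)) = cnj (e k m)"
      using B.cnj_e_cancel[OF k a] by simp
    then show "e k a * (of_real (\<phi> (x \<otimes> \<pi> (m \<otimes>\<^bsub>B\<^esub> a))) * cnj (e k (m \<otimes>\<^bsub>B\<^esub> a))) =
        of_real (\<phi> (x \<otimes> \<pi> (m \<otimes>\<^bsub>B\<^esub> a))) * cnj (e k m)"
      by (simp add: mult.left_commute)
  qed
  finally have "\<Phi> (x \<otimes> \<pi> a) - e k a * \<Phi> x = (\<Sum>m\<in>carrier B.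
      of_real (\<phi> (x \<otimes> \<pi> a \<otimes> \<pi> m) - \<phi> (x \<otimes> \<pi> (m \<otimes>\<^bsub>B\<^esub> a))) * cnj (e k m)) / of_nat ?n"
    unfolding \<Phi> by (simp add: sum_subtractf diff_divide_distrib left_diff_distrib)
  also have "cmod \<dots> = cmod (\<Sum>m\<in>carrier B.
      of_real (\<phi> (x \<otimes> \<pi> a \<otimes> \<pi> m) - \<phi> (x \<otimes> \<pi> (m \<otimes>\<^bsub>B\<^esub> a))) * cnj (e k m)) / ?n"
    by (simp add: norm_divide)
  also have "\<dots> \<le> (\<Sum>m\<in>carrier B. \<epsilon>) / ?n"
  proof (intro divide_right_mono order.trans[OF norm_sum] sum_mono)
    fix m assume m: "m \<in> carrier B"
    obtain w where w: "w \<in> AP \<epsilon>" "\<pi> m \<otimes> \<pi> a = \<pi> (m \<otimes>\<^bsub>B\<^esub> a) \<otimes> w" using err[OF m a] by blast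
    have ma: "m \<otimes>\<^bsub>B\<^esub> a \<in> carrier B" using m a by simp
    have c: "\<pi> m \<in> carrier G" "\<pi> a \<in> carrier G" "\<pi> (m \<otimes>\<^bsub>B\<^esub> a) \<in> carrier G" "w \<in> carrier G"
      using \<pi> m a ma w(1) AP_carrier by auto
    have "x \<otimes> \<pi> a \<otimes> \<pi> m = x \<otimes> (\<pi> m \<otimes> \<pi> a)" using c x by (simp add: m_ac)
    also have "\<dots> = x \<otimes> \<pi> (m \<otimes>\<^bsub>B\<^esub> a) \<otimes> w" unfolding w(2) using c x by (simp add: m_assoc)
    finally have "\<bar>\<phi> (x \<otimes> \<pi> a \<otimes> \<pi> m) - \<phi> (x \<otimes> \<pi> (m \<otimes>\<^bsub>B\<^esub> a))\<bar> \<le> \<epsilon>"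
      using AP_D[OF w(1), of "x \<otimes> \<pi> (m \<otimes>\<^bsub>B\<^esub> a)"] c x by simp
    then show "cmod (of_real (\<phi> (x \<otimes> \<pi> a \<otimes> \<pi> m) - \<phi> (x \<otimes> \<pi> (m \<otimes>\<^bsub>B\<^esub> a))) * cnj (e k m)) \<le> \<epsilon>"
      using B.norm_e[OF k m] by (simp only: norm_mult norm_of_real complex_mod_cnj mult_1_right)
  qed auto
  also have "\<dots> = \<epsilon>" using n by simp
  finally show ?thesis .
qed

text \<open>
  The difference \<open>\<phi> (g \<otimes> t) - \<phi> t\<close>, pulled back to any finite group that approximates \<open>G\<close> well enough,
  has a Fourier coefficient that is bounded below by a constant depending on \<open>\<phi>\<close> alone. It equals
  \<open>1\<close> at the neutral element and therefore stays above \<open>1/2\<close> on the almost periods of tolerance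
  \<open>1/4\<close>; as these are frequent, its mean square is bounded below. For the same reason its
  autocorrelation is bounded below at all almost periods of a second, much smaller tolerance, which
  are frequent as well. A large autocorrelation forces a large coefficient.
\<close>

lemma uniform_large_coeff:
  assumes \<phi>: "\<And>x. x \<in> carrier G \<Longrightarrow> 0 \<le> \<phi> x \<and> \<phi> x \<le> 1" and g: "g \<in> carrier G" "\<phi> \<one> = 0" "\<phi> g = 1"
  obtains \<delta> \<theta> :: real where "\<delta> > 0" "\<theta> > 0"
    "\<And>B :: ('c, 'd) monoid_scheme. \<And>K :: 'k set. \<And>e \<pi>.
      finite_fourier B K e \<Longrightarrow> \<pi> \<in> carrier B \<rightarrow> carrier G \<Longrightarrow>
      (\<And>m m'. m \<in> carrier B \<Longrightarrow> m' \<in> carrier B \<Longrightarrow>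
        \<exists>w\<in>AP \<theta>. \<pi> m \<otimes> \<pi> m' = \<pi> (m \<otimes>\<^bsub>B\<^esub> m') \<otimes> w) \<Longrightarrow>
      \<exists>k\<in>K. \<delta> * card (carrier B) \<le>
        cmod (\<Sum>m\<in>carrier B. of_real (\<phi> (g \<otimes> \<pi> m) - \<phi> (\<pi> m)) * cnj (e k m))"
proof -
  obtain Z1 where Z1: "finite Z1" "Z1 \<subseteq> carrier G"
      "\<And>x. x \<in> carrier G \<Longrightarrow> \<exists>b\<in>Z1. x \<otimes> inv b \<in> AP ((1/4) / 3)"
    using finite_net[of "(1/4) / 3"] by auto
  define k1 where "k1 = real (card Z1)"
  have "Z1 \<noteq> {}" using Z1(3)[OF one_closed] by blast
  then have k1: "k1 \<ge> 1" using Z1(1) by (simp add: k1_def Suc_leI card_gt_0_iff)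
  \<comment> \<open>With this choice the error \<open>4 * \<theta>\<close> of the autocorrelation is half of the lower bound
    \<open>1 / (4 * k1)\<close> for the mean square; \<open>c\<close> below is the other half.\<close>
  define \<theta> where "\<theta> = 1 / (32 * k1)"
  have \<theta>: "\<theta> > 0" "\<theta> \<le> 1/4" using k1 by (simp_all add: \<theta>_def field_simps)
  obtain Z2 where Z2: "finite Z2" "Z2 \<subseteq> carrier G"
      "\<And>x. x \<in> carrier G \<Longrightarrow> \<exists>b\<in>Z2. x \<otimes> inv b \<in> AP (\<theta> / 3)"
    using finite_net[of "\<theta> / 3"] \<theta> by auto
  define k2 where "k2 = real (card Z2)"
  have "Z2 \<noteq> {}" using Z2(3)[OF one_closed] by blast
  then have k2: "k2 \<ge> 1" using Z2(1) by (simp add: k2_def Suc_leI card_gt_0_iff)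
  define c where "c = 1 / (8 * k1)"
  define \<psi> where "\<psi> = (\<lambda>t. \<phi> (g \<otimes> t) - \<phi> t)"
  have \<psi>_bound: "\<bar>\<psi> t\<bar> \<le> 1" if "t \<in> carrier G" for t
    using \<phi>[of t] \<phi>[of "g \<otimes> t"] that g by (auto simp: \<psi>_def abs_le_iff)
  have \<psi>_AP: "\<bar>\<psi> (t \<otimes> w) - \<psi> t\<bar> \<le> 2 * \<eta>" if t: "t \<in> carrier G" and w: "w \<in> AP \<eta>" for t w \<eta>
    using AP_D[OF w t] AP_D[OF w, of "g \<otimes> t"] t g AP_carrier[OF w]
    unfolding \<psi>_def by (simp add: m_assoc abs_le_iff)
  show thesis
  proof (rule that[of "c / k2" "\<theta> / 3"])
    show "c / k2 > 0" "\<theta> / 3 > 0" using k1 k2 \<theta> by (simp_all add: c_def)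
    fix B :: "('c, 'd) monoid_scheme" and K :: "'k set" and e \<pi>
    assume "finite_fourier B K e" and \<pi>: "\<pi> \<in> carrier B \<rightarrow> carrier G"
      and err: "\<And>m m'. m \<in> carrier B \<Longrightarrow> m' \<in> carrier B \<Longrightarrow>
        \<exists>w\<in>AP (\<theta> / 3). \<pi> m \<otimes> \<pi> m' = \<pi> (m \<otimes>\<^bsub>B\<^esub> m') \<otimes> w"
    interpret B: finite_fourier B K e by fact
    define n where "n = real (card (carrier B))"
    have n: "n > 0" using B.card_carrier_pos by (simp add: n_def)
    have err1: "\<exists>w\<in>AP ((1/4) / 3). \<pi> m \<otimes> \<pi> m' = \<pi> (m \<otimes>\<^bsub>B\<^esub> m') \<otimes> w"
      if "m \<in> carrier B" "m' \<in> carrier B" for m m'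
      using err[OF that] AP_mono[of _ "\<theta> / 3" "(1/4) / 3"] \<theta> by auto
    let ?S1 = "{m \<in> carrier B. \<pi> m \<in> AP (1/4)}" and ?S2 = "{m \<in> carrier B. \<pi> m \<in> AP \<theta>}"
    have "card (carrier B) \<le> card Z1 * card ?S1"
      by (rule frequent_returns[OF B.is_group B.finite_carrier \<pi> err1 Z1])
    then have S1: "n \<le> k1 * card ?S1"
      unfolding n_def k1_def by (metis of_nat_mono of_nat_mult)
    have "card (carrier B) \<le> card Z2 * card ?S2"
      by (rule frequent_returns[OF B.is_group B.finite_carrier \<pi> err Z2])
    then have S2: "n \<le> k2 * card ?S2"
      unfolding n_def k2_def by (metis of_nat_mono of_nat_mult)
    define f where "f = (\<lambda>m. \<psi> (\<pi> m))"
    have \<pi>c: "\<pi> m \<in> carrier G" if "m \<in> carrier B" for m using \<pi> that by blast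
    have f_bound: "\<bar>f m\<bar> \<le> 1" if "m \<in> carrier B" for m
      using \<psi>_bound[OF \<pi>c[OF that]] by (simp add: f_def)
    have f_large: "f m \<ge> 1/2" if "m \<in> ?S1" for m
    proof -
      have "\<bar>\<psi> (\<one> \<otimes> \<pi> m) - \<psi> \<one>\<bar> \<le> 2 * (1/4)" using that by (intro \<psi>_AP) auto
      moreover have "\<psi> \<one> = 1" using g by (simp add: \<psi>_def)
      moreover have "\<one> \<otimes> \<pi> m = \<pi> m" using \<pi>c that by simp
      ultimately have "\<bar>\<psi> (\<pi> m) - 1\<bar> \<le> 1/2" by simp
      then show ?thesis unfolding f_def by linarith
    qed
    have "n / (4 * k1) \<le> card ?S1 * (1/4)"
      using S1 k1 by (simp add: field_simps)
    also have "\<dots> = (\<Sum>m\<in>?S1. (1/2)\<^sup>2)" by (simp add: power2_eq_square)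
    also have "\<dots> \<le> (\<Sum>m\<in>?S1. (f m)\<^sup>2)"
      using f_large by (intro sum_mono power_mono) auto
    also have "\<dots> \<le> (\<Sum>m\<in>carrier B. (f m)\<^sup>2)"
      using B.finite_carrier by (intro sum_mono2) auto
    finally have energy: "n / (4 * k1) \<le> (\<Sum>m\<in>carrier B. (f m)\<^sup>2)" .
    let ?F = "\<lambda>m. complex_of_real (f m)"
    have auto_large: "c * n \<le> cmod (B.autocorrelation ?F x)" if x: "x \<in> ?S2" for x
    proof -
      have diff: "\<bar>f (x \<otimes>\<^bsub>B\<^esub> y) - f y\<bar> \<le> 4 * \<theta>" if y: "y \<in> carrier B" for y
      proof -
        have xB: "x \<in> carrier B" and xA: "\<pi> x \<in> AP \<theta>" using x by auto
        obtain w where w: "w \<in> AP (\<theta> / 3)" "\<pi> x \<otimes> \<pi> y = \<pi> (x \<otimes>\<^bsub>B\<^esub> y) \<otimes> w"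
          using err[OF xB y] by blast
        have xy: "x \<otimes>\<^bsub>B\<^esub> y \<in> carrier B" using xB y by simp
        note cc = \<pi>c[OF xB] \<pi>c[OF y] \<pi>c[OF xy] AP_carrier[OF w(1)]
        have "\<pi> (x \<otimes>\<^bsub>B\<^esub> y) = \<pi> x \<otimes> \<pi> y \<otimes> inv w"
          unfolding w(2) using cc by (simp add: m_assoc)
        also have "\<dots> = \<pi> y \<otimes> (\<pi> x \<otimes> inv w)" using cc by (simp add: m_ac)
        finally have "f (x \<otimes>\<^bsub>B\<^esub> y) = \<psi> (\<pi> y \<otimes> (\<pi> x \<otimes> inv w))" by (simp add: f_def)
        moreover have "\<bar>\<psi> (\<pi> y \<otimes> (\<pi> x \<otimes> inv w)) - \<psi> (\<pi> y)\<bar> \<le> 2 * (\<theta> + \<theta> / 3)"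
          by (rule \<psi>_AP[OF cc(2) AP_mult[OF xA AP_inv[OF w(1)]]])
        ultimately have "\<bar>f (x \<otimes>\<^bsub>B\<^esub> y) - f y\<bar> \<le> 2 * (\<theta> + \<theta> / 3)"
          unfolding f_def by (simp only:)
        then show ?thesis using \<theta> by simp
      qed
      have "c * n = n / (4 * k1) - 4 * \<theta> * n"
        using k1 by (simp add: c_def \<theta>_def field_simps)
      also have "\<dots> \<le> (\<Sum>y\<in>carrier B. (f y)\<^sup>2) - (\<Sum>y\<in>carrier B. 4 * \<theta>)"
        using energy by (simp add: n_def mult_ac)
      also have "\<dots> = (\<Sum>y\<in>carrier B. (f y)\<^sup>2 - 4 * \<theta>)" by (simp add: sum_subtractf)
      also have "\<dots> \<le> (\<Sum>y\<in>carrier B. f (x \<otimes>\<^bsub>B\<^esub> y) * f y)"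
      proof (intro sum_mono)
        fix y assume y: "y \<in> carrier B"
        have "\<bar>(f (x \<otimes>\<^bsub>B\<^esub> y) - f y) * f y\<bar> \<le> 4 * \<theta> * 1"
          unfolding abs_mult using diff[OF y] f_bound[OF y] by (intro mult_mono) auto
        then show "(f y)\<^sup>2 - 4 * \<theta> \<le> f (x \<otimes>\<^bsub>B\<^esub> y) * f y"
          by (simp add: left_diff_distrib power2_eq_square abs_le_iff)
      qed
      also have "\<dots> = Re (B.autocorrelation ?F x)"
        unfolding B.autocorrelation_def by simp
      also have "\<dots> \<le> cmod (B.autocorrelation ?F x)" by (rule complex_Re_le_cmod)
      finally show ?thesis .
    qed
    obtain k where k: "k \<in> K" and large:
      "(\<Sum>x\<in>carrier B. (cmod (B.autocorrelation ?F x))\<^sup>2) \<le>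
        (cmod (B.coeff ?F k))\<^sup>2 * (\<Sum>x\<in>carrier B. (cmod (?F x))\<^sup>2)"
      by (rule B.large_coeff)
    have cn: "c * n \<ge> 0" using n k1 by (simp add: c_def)
    have "(n / k2) * (c * n)\<^sup>2 \<le> card ?S2 * (c * n)\<^sup>2"
      using S2 k2 by (intro mult_right_mono) (auto simp: field_simps)
    also have "\<dots> = (\<Sum>x\<in>?S2. (c * n)\<^sup>2)" by simp
    also have "\<dots> \<le> (\<Sum>x\<in>?S2. (cmod (B.autocorrelation ?F x))\<^sup>2)"
      using auto_large cn by (intro sum_mono power_mono) auto
    also have "\<dots> \<le> (\<Sum>x\<in>carrier B. (cmod (B.autocorrelation ?F x))\<^sup>2)"
      using B.finite_carrier by (intro sum_mono2) auto
    also note large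
    also have "(\<Sum>x\<in>carrier B. (cmod (?F x))\<^sup>2) \<le> (\<Sum>x\<in>carrier B. 1)"
      using f_bound by (intro sum_mono) (simp add: abs_square_le_1)
    then have "(cmod (B.coeff ?F k))\<^sup>2 * (\<Sum>x\<in>carrier B. (cmod (?F x))\<^sup>2) \<le> (cmod (B.coeff ?F k))\<^sup>2 * n"
      by (intro mult_left_mono) (auto simp: n_def)
    finally have "n * ((c * n)\<^sup>2 / k2) \<le> n * (cmod (B.coeff ?F k))\<^sup>2"
      by (simp add: mult.commute)
    then have "(c * n)\<^sup>2 / k2 \<le> (cmod (B.coeff ?F k))\<^sup>2"
      by (simp only: mult_le_cancel_left_pos[OF n])
    moreover have "(c / k2 * n)\<^sup>2 \<le> (c * n)\<^sup>2 / k2"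
    proof -
      have "(c / k2 * n)\<^sup>2 = (c * n)\<^sup>2 / k2 / k2" by (simp add: power2_eq_square field_simps)
      also have "\<dots> \<le> (c * n)\<^sup>2 / k2" using k2
        by (simp add: divide_le_eq mult_le_cancel_left1 zero_le_divide_iff)
      finally show ?thesis .
    qed
    ultimately have "c / k2 * n \<le> cmod (B.coeff ?F k)"
      by (meson norm_ge_zero order.trans power2_le_imp_le)
    then show "\<exists>k\<in>K. c / k2 * real (card (carrier B)) \<le>
        cmod (\<Sum>m\<in>carrier B. of_real (\<phi> (g \<otimes> \<pi> m) - \<phi> (\<pi> m)) * cnj (e k m))"
      using k by (auto simp: B.coeff_def f_def \<psi>_def n_def)
  qed
qed

text \<open>
  The function \<open>\<Phi>\<close> is the Fourier component of \<open>\<phi>\<close> along a character of a finite group whose image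
  contains \<open>F\<close>. As an average of translates of \<open>\<phi>\<close> it inherits the almost periods of \<open>\<phi>\<close>, and the
  difference of its values at \<open>g\<close> and \<open>\<one>\<close> is the coefficient that is known to be large. Because \<open>\<delta>\<close>
  is chosen before \<open>F\<close> and \<open>\<epsilon>\<close>, this difference cannot disappear in the limit.
\<close>

lemma approximate_characters:
  assumes \<phi>: "\<And>x. x \<in> carrier G \<Longrightarrow> 0 \<le> \<phi> x \<and> \<phi> x \<le> 1" and g: "g \<in> carrier G" "\<phi> \<one> = 0" "\<phi> g = 1"
  obtains \<delta> :: real where "\<delta> > 0"
    "\<And>F \<epsilon>. finite F \<Longrightarrow> F \<subseteq> carrier G \<Longrightarrow> \<epsilon> > 0 \<Longrightarrow> \<exists>\<Phi> :: 'a \<Rightarrow> complex.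
      (\<forall>x\<in>carrier G. cmod (\<Phi> x) \<le> 1) \<and>
      (\<forall>\<eta>. \<forall>w\<in>AP \<eta>. \<forall>x\<in>carrier G. cmod (\<Phi> (x \<otimes> w) - \<Phi> x) \<le> \<eta>) \<and>
      \<delta> \<le> cmod (\<Phi> g - \<Phi> \<one>) \<and>
      (\<forall>a\<in>F. \<exists>z. cmod z = 1 \<and> (\<forall>x\<in>carrier G. cmod (\<Phi> (x \<otimes> a) - z * \<Phi> x) \<le> \<epsilon>))"
proof (rule uniform_large_coeff[where 'c = "'a \<Rightarrow> int" and 'd = unit and 'k = "'a \<Rightarrow> int", OF \<phi> g], assumption)
  fix \<delta> \<theta> :: real
  assume \<delta>: "\<delta> > 0" "\<theta> > 0" and coeff:
    "\<And>B :: ('a \<Rightarrow> int) monoid. \<And>K :: ('a \<Rightarrow> int) set. \<And>e \<pi>.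
      finite_fourier B K e \<Longrightarrow> \<pi> \<in> carrier B \<rightarrow> carrier G \<Longrightarrow>
      (\<And>m m'. m \<in> carrier B \<Longrightarrow> m' \<in> carrier B \<Longrightarrow>
        \<exists>w\<in>AP \<theta>. \<pi> m \<otimes> \<pi> m' = \<pi> (m \<otimes>\<^bsub>B\<^esub> m') \<otimes> w) \<Longrightarrow>
      \<exists>k\<in>K. \<delta> * card (carrier B) \<le>
        cmod (\<Sum>m\<in>carrier B. of_real (\<phi> (g \<otimes> \<pi> m) - \<phi> (\<pi> m)) * cnj (e k m))"
  show thesis
  proof (rule that[OF \<delta>(1)])
    fix F and \<epsilon> :: real
    assume F: "finite F" "F \<subseteq> carrier G" and \<epsilon>: "\<epsilon> > 0"
    have pos: "min \<theta> \<epsilon> > 0" using \<delta> \<epsilon> by simp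
    obtain N and \<pi> :: "('a \<Rightarrow> int) \<Rightarrow> 'a" where N: "\<And>a. a \<in> F \<Longrightarrow> N a > 0"
      and \<pi>: "\<pi> \<in> carrier (cyclic_product F N) \<rightarrow> carrier G"
      and onto: "\<And>a. a \<in> F \<Longrightarrow> \<exists>m\<in>carrier (cyclic_product F N). \<pi> m = a"
      and err: "\<And>m m'. m \<in> carrier (cyclic_product F N) \<Longrightarrow> m' \<in> carrier (cyclic_product F N) \<Longrightarrow>
       \<exists>w\<in>AP (min \<theta> \<epsilon>). \<pi> m \<otimes> \<pi> m' = \<pi> (m \<otimes>\<^bsub>cyclic_product F N\<^esub> m') \<otimes> w"
      by (rule cyclic_product_approximation[OF F pos]) (rule that)
    let ?B = "cyclic_product F N" and ?K = "carrier (cyclic_product F N)"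
    define e where "e = (\<lambda>k m :: 'a \<Rightarrow> int. \<Prod>a\<in>F. cis (2 * pi * of_int (k a) * of_int (m a) / real (N a)))"
    have ff: "finite_fourier ?B ?K e"
      unfolding e_def by (rule finite_fourier_cyclic_product[OF F(1) N])
    interpret B: finite_fourier ?B ?K e by (rule ff)
    have err_\<theta>: "\<exists>w\<in>AP \<theta>. \<pi> m \<otimes> \<pi> m' = \<pi> (m \<otimes>\<^bsub>?B\<^esub> m') \<otimes> w"
      and err_\<epsilon>: "\<exists>w\<in>AP \<epsilon>. \<pi> m \<otimes> \<pi> m' = \<pi> (m \<otimes>\<^bsub>?B\<^esub> m') \<otimes> w"
      if "m \<in> ?K" "m' \<in> ?K" for m m'
      using err[OF that] AP_mono[of _ "min \<theta> \<epsilon>"] by (meson min.cobounded1 min.cobounded2)+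
    obtain k where k: "k \<in> ?K" and large: "\<delta> * card ?K \<le>
        cmod (\<Sum>m\<in>?K. of_real (\<phi> (g \<otimes> \<pi> m) - \<phi> (\<pi> m)) * cnj (e k m))"
      using coeff[OF ff \<pi> err_\<theta>] by blast
    define n where "n = card ?K"
    have n: "n > 0" using B.card_carrier_pos by (simp add: n_def)
    define \<Phi> where "\<Phi> = (\<lambda>x. (\<Sum>m\<in>?K. of_real (\<phi> (x \<otimes> \<pi> m)) * cnj (e k m)) / of_nat (card ?K))"
    have \<pi>c: "\<pi> m \<in> carrier G" if "m \<in> ?K" for m using \<pi> that by blast
    have bound: "cmod ((\<Sum>m\<in>?K. of_real (h m) * cnj (e k m)) / of_nat (card ?K)) \<le> \<eta>"
      if "\<And>m. m \<in> ?K \<Longrightarrow> \<bar>h m\<bar> \<le> \<eta>" for h :: "('a \<Rightarrow> int) \<Rightarrow> real" and \<eta>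
    proof -
      have "cmod (\<Sum>m\<in>?K. of_real (h m) * cnj (e k m)) \<le> (\<Sum>m\<in>?K. \<eta>)"
      proof (intro order.trans[OF norm_sum] sum_mono)
        fix m assume m: "m \<in> ?K"
        show "cmod (of_real (h m) * cnj (e k m)) \<le> \<eta>"
          unfolding norm_mult complex_mod_cnj B.norm_e[OF k m] using that[OF m] by simp
      qed
      then show ?thesis using n by (simp add: norm_divide divide_le_eq n_def mult.commute)
    qed
    have diff: "\<Phi> x - \<Phi> y = (\<Sum>m\<in>?K. of_real (\<phi> (x \<otimes> \<pi> m) - \<phi> (y \<otimes> \<pi> m)) * cnj (e k m)) / of_nat (card ?K)"
      for x y
      unfolding \<Phi>_def of_real_diff left_diff_distrib sum_subtractf diff_divide_distrib ..
    have 1: "cmod (\<Phi> x) \<le> 1" if "x \<in> carrier G" for x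
      unfolding \<Phi>_def
    proof (rule bound)
      fix m assume "m \<in> ?K"
      then show "\<bar>\<phi> (x \<otimes> \<pi> m)\<bar> \<le> 1" using \<phi>[of "x \<otimes> \<pi> m"] \<pi>c[of m] that by simp
    qed
    have 2: "cmod (\<Phi> (x \<otimes> w) - \<Phi> x) \<le> \<eta>" if w: "w \<in> AP \<eta>" and x: "x \<in> carrier G" for \<eta> w x
      unfolding diff
    proof (rule bound)
      fix m assume "m \<in> ?K"
      then have "\<pi> m \<in> carrier G" by (rule \<pi>c)
      then have "x \<otimes> w \<otimes> \<pi> m = x \<otimes> \<pi> m \<otimes> w" "x \<otimes> \<pi> m \<in> carrier G"
        using x AP_carrier[OF w] by (simp_all add: m_ac)
      then show "\<bar>\<phi> (x \<otimes> w \<otimes> \<pi> m) - \<phi> (x \<otimes> \<pi> m)\<bar> \<le> \<eta>" using AP_D[OF w] by simp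
    qed
    have "\<Phi> g - \<Phi> \<one> = (\<Sum>m\<in>?K. of_real (\<phi> (g \<otimes> \<pi> m) - \<phi> (\<pi> m)) * cnj (e k m)) / of_nat (card ?K)"
      unfolding diff using \<pi>c by (intro arg_cong2[where f = "(/)"] sum.cong refl) simp
    then have 3: "\<delta> \<le> cmod (\<Phi> g - \<Phi> \<one>)"
      using large n by (simp add: norm_divide le_divide_eq n_def)
    have 4: "\<exists>z. cmod z = 1 \<and> (\<forall>x\<in>carrier G. cmod (\<Phi> (x \<otimes> a) - z * \<Phi> x) \<le> \<epsilon>)" if a: "a \<in> F" for a
    proof -
      obtain m where m: "m \<in> ?K" "\<pi> m = a" using onto[OF a] by blast
      have "cmod (\<Phi> (x \<otimes> \<pi> m) - e k m * \<Phi> x) \<le> \<epsilon>" if x: "x \<in> carrier G" for x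
        by (rule approximate_eigenfunction[where \<Phi> = \<Phi> and \<pi> = \<pi> and e = e and k = k,
              OF ff k \<pi> err_\<epsilon> _ m(1) x]) (simp_all only: \<Phi>_def)
      then show ?thesis using m B.norm_e[OF k m(1)] by blast
    qed
    show "\<exists>\<Phi>. (\<forall>x\<in>carrier G. cmod (\<Phi> x) \<le> 1) \<and>
      (\<forall>\<eta>. \<forall>w\<in>AP \<eta>. \<forall>x\<in>carrier G. cmod (\<Phi> (x \<otimes> w) - \<Phi> x) \<le> \<eta>) \<and>
      \<delta> \<le> cmod (\<Phi> g - \<Phi> \<one>) \<and>
      (\<forall>a\<in>F. \<exists>z. cmod z = 1 \<and> (\<forall>x\<in>carrier G. cmod (\<Phi> (x \<otimes> a) - z * \<Phi> x) \<le> \<epsilon>))"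
      using 1 2 3 4 by (intro exI[of _ \<Phi>]) blast
  qed
qed

end

section \<open>Characters of a compact abelian group separate points from subgroups\<close>

lemma (in comm_group) SUP_over_subgroup_translate:
  assumes H: "subgroup H G" "h \<in> H" and x: "x \<in> carrier G"
  shows "(\<lambda>k. u (x \<otimes> h \<otimes> k)) ` H = (\<lambda>k. u (x \<otimes> k)) ` H"
proof (intro equalityI image_subsetI)
  have hc: "h \<in> carrier G" using H by (simp add: subgroup.mem_carrier)
  show "u (x \<otimes> h \<otimes> k) \<in> (\<lambda>k. u (x \<otimes> k)) ` H" if k: "k \<in> H" for k
  proof (rule image_eqI)
    show "u (x \<otimes> h \<otimes> k) = u (x \<otimes> (h \<otimes> k))"
      using x hc subgroup.mem_carrier[OF H(1) k] by (simp add: m_assoc)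
    show "h \<otimes> k \<in> H" using H k by (simp add: subgroup.m_closed)
  qed
  show "u (x \<otimes> k) \<in> (\<lambda>k. u (x \<otimes> h \<otimes> k)) ` H" if k: "k \<in> H" for k
  proof (rule image_eqI)
    show "u (x \<otimes> k) = u (x \<otimes> h \<otimes> (inv h \<otimes> k))"
    proof -
      have kc: "k \<in> carrier G" by (rule subgroup.mem_carrier[OF H(1) k])
      have "x \<otimes> h \<otimes> (inv h \<otimes> k) = x \<otimes> (h \<otimes> inv h) \<otimes> k"
        using x hc kc by (simp only: m_assoc m_closed inv_closed)
      also have "\<dots> = x \<otimes> k" using x hc kc by simp
      finally show ?thesis by simp
    qed
    show "inv h \<otimes> k \<in> H" using H k by (simp add: subgroup.m_closed subgroup.m_inv_closed)
  qed
qed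

locale compact_abelian_group = topological_group G T + comm_group G
  for G :: "('a, 'b) monoid_scheme" (structure) and T :: "'a topology" +
  assumes compact: "compact_space T" and Hausdorff: "Hausdorff_space T"
begin

lemma continuous_map_mult_right:
  assumes "b \<in> carrier G"
  shows "continuous_map T T (\<lambda>x. x \<otimes> b)"
proof -
  have "continuous_map T (prod_topology T T) (\<lambda>x. (x, b))"
    using assms by (simp add: continuous_map_pairwise o_def topspace_eq)
  from continuous_map_compose[OF this continuous_map_mult]
  show ?thesis by (simp add: o_def)
qed

text \<open>
  Uniform continuity. The pairs that witness a displacement of at least \<open>\<eta>\<close> form a closed set, and
  its projection to the second factor is closed because the first factor is compact.
\<close>

lemma ex_nbhd_almost_periods:
  assumes u: "continuous_map T euclideanreal u" and \<eta>: "\<eta> > 0"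
  obtains U where "openin T U" "\<one> \<in> U" "U \<subseteq> almost_periods G u \<eta>"
proof -
  define d where "d = (\<lambda>p. \<bar>u (fst p \<otimes> snd p) - u (fst p)\<bar>)"
  have "continuous_map (prod_topology T T) euclideanreal (\<lambda>p. u (fst p \<otimes> snd p))"
    using continuous_map_compose[OF continuous_map_mult u] by (simp add: o_def case_prod_unfold)
  moreover have "continuous_map (prod_topology T T) euclideanreal (\<lambda>p. u (fst p))"
    using continuous_map_compose[OF continuous_map_fst u] by (simp add: o_def)
  ultimately have "continuous_map (prod_topology T T) euclideanreal d"
    unfolding d_def by (intro continuous_intros)
  then have "closedin (prod_topology T T) {p \<in> topspace (prod_topology T T). d p \<in> {\<eta>..}}"
    by (rule closedin_continuous_map_preimage) simp
  then have closed: "closedin T (snd ` {p \<in> topspace (prod_topology T T). d p \<in> {\<eta>..}})"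
    using closed_map_snd[OF compact] by (auto simp: closed_map_def)
  define U where "U = topspace T - snd ` {p \<in> topspace (prod_topology T T). d p \<in> {\<eta>..}}"
  show thesis
  proof (rule that[of U])
    show "openin T U" unfolding U_def using closed by blast
    show "\<one> \<in> U" using \<eta> by (auto simp: U_def d_def topspace_eq)
    show "U \<subseteq> almost_periods G u \<eta>"
    proof
      fix w assume w: "w \<in> U"
      have "\<bar>u (x \<otimes> w) - u x\<bar> \<le> \<eta>" if "x \<in> carrier G" for x
      proof (rule ccontr)
        assume "\<not> \<bar>u (x \<otimes> w) - u x\<bar> \<le> \<eta>"
        then have "w \<in> snd ` {p \<in> topspace (prod_topology T T). d p \<in> {\<eta>..}}"
          using that w by (intro image_eqI[of _ _ "(x, w)"]) (auto simp: d_def U_def topspace_eq)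
        then show False using w by (simp add: U_def)
      qed
      then show "w \<in> almost_periods G u \<eta>"
        using w by (simp add: almost_periods_def U_def topspace_eq)
    qed
  qed
qed

lemma almost_periodicI:
  assumes "\<And>\<eta>. \<eta> > 0 \<Longrightarrow> \<exists>U. openin T U \<and> \<one> \<in> U \<and> U \<subseteq> almost_periods G \<phi> \<eta>"
  shows "almost_periodic G \<phi>"
proof
  fix \<eta> :: real assume "\<eta> > 0"
  then obtain U where U: "openin T U" "\<one> \<in> U" "U \<subseteq> almost_periods G \<phi> \<eta>" using assms by blast
  define V where "V = (\<lambda>b. {x \<in> topspace T. x \<otimes> inv b \<in> U})"
  have "openin T (V b)" if "b \<in> carrier G" for b
    unfolding V_def using that
    by (intro openin_continuous_map_preimage[OF continuous_map_mult_right U(1)]) simp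
  moreover have "topspace T \<subseteq> \<Union>(V ` carrier G)"
    using U(2) by (auto simp: V_def topspace_eq)
  ultimately obtain \<F> where \<F>: "finite \<F>" "\<F> \<subseteq> V ` carrier G" "topspace T \<subseteq> \<Union>\<F>"
    using compact unfolding compact_space_alt by (metis (no_types, lifting) imageE)
  then obtain Z where Z: "Z \<subseteq> carrier G" "finite Z" "\<F> = V ` Z"
    by (meson finite_subset_image)
  have "\<exists>b\<in>Z. x \<otimes> inv b \<in> almost_periods G \<phi> \<eta>" if "x \<in> carrier G" for x
  proof -
    have "x \<in> \<Union>(V ` Z)" using \<F>(3) Z(3) that by (auto simp: topspace_eq)
    then show ?thesis using U(3) by (auto simp: V_def)
  qed
  then show "\<exists>Z. finite Z \<and> Z \<subseteq> carrier G \<and> (\<forall>x\<in>carrier G. \<exists>b\<in>Z. x \<otimes> inv b \<in> almost_periods G \<phi> \<eta>)"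
    using Z by blast
qed

text \<open>
  Urysohn's lemma separates \<open>g\<close> from the closure of \<open>H\<close>; the supremum over the translates by elements
  of \<open>H\<close> makes the function invariant under \<open>H\<close> without enlarging its modulus of continuity. In this
  way characters of the quotient by \<open>H\<close> are obtained without forming the quotient.
\<close>

lemma ex_invariant_separating_function:
  assumes H: "subgroup H G" and g: "g \<in> carrier G" "g \<notin> T closure_of H"
  obtains \<phi> where "\<And>x. x \<in> carrier G \<Longrightarrow> 0 \<le> \<phi> x \<and> \<phi> x \<le> 1" "\<phi> \<one> = 0" "\<phi> g = 1"
    "\<And>\<eta>. \<eta> > 0 \<Longrightarrow> \<exists>U. openin T U \<and> \<one> \<in> U \<and> U \<subseteq> almost_periods G \<phi> \<eta>"
    "H \<subseteq> almost_periods G \<phi> 0"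
proof -
  have Hc: "H \<subseteq> carrier G" by (rule subgroup.subset[OF H])
  have H1: "\<one> \<in> H" by (rule subgroup.one_closed[OF H])
  have "closedin T {g}"
    using g Hausdorff by (simp add: closedin_Hausdorff_sing_eq topspace_eq)
  then obtain u where u: "continuous_map T (top_of_set {0..1::real}) u"
      "u ` (T closure_of H) \<subseteq> {0}" "u ` {g} \<subseteq> {1}"
    using Urysohn_lemma[of T "T closure_of H" "{g}" 0 1] g
      compact_Hausdorff_or_regular_imp_normal_space[OF compact] Hausdorff
    by (auto simp: disjnt_def)
  then have uc: "continuous_map T euclideanreal u" and u01: "\<And>x. x \<in> carrier G \<Longrightarrow> 0 \<le> u x \<and> u x \<le> 1"
    by (auto simp: continuous_map_in_subtopology topspace_eq image_subset_iff)
  have uH: "u h = 0" if "h \<in> H" for h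
    using u(2) closure_of_subset[of H T] Hc that by (auto simp: topspace_eq)
  define \<phi> where "\<phi> = (\<lambda>x. SUP h\<in>H. u (x \<otimes> h))"
  have xh: "x \<otimes> h \<in> carrier G" if "x \<in> carrier G" "h \<in> H" for x h
    using that Hc by auto
  have bdd: "bdd_above ((\<lambda>h. u (x \<otimes> h)) ` H)" if "x \<in> carrier G" for x
    using u01 xh[OF that] by (intro bdd_aboveI[of _ 1]) auto
  have \<phi>_ge: "u (x \<otimes> h) \<le> \<phi> x" if "x \<in> carrier G" "h \<in> H" for x h
    unfolding \<phi>_def using bdd[OF that(1)] that(2) by (rule cSUP_upper2) simp
  have \<phi>_le: "\<phi> x \<le> c" if "\<And>h. h \<in> H \<Longrightarrow> u (x \<otimes> h) \<le> c" for x c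
    unfolding \<phi>_def using H1 that by (intro cSUP_least) auto
  have bounds: "0 \<le> \<phi> x \<and> \<phi> x \<le> 1" if "x \<in> carrier G" for x
    using \<phi>_ge[OF that H1] u01[OF xh[OF that H1]] \<phi>_le[of x 1] u01 xh[OF that] by force
  have sub: "almost_periods G u \<eta> \<subseteq> almost_periods G \<phi> \<eta>" for \<eta>
  proof
    fix w assume w: "w \<in> almost_periods G u \<eta>"
    then have wc: "w \<in> carrier G" by (simp add: almost_periods_def)
    have "\<bar>\<phi> (x \<otimes> w) - \<phi> x\<bar> \<le> \<eta>" if x: "x \<in> carrier G" for x
    proof -
      have close: "\<bar>u (x \<otimes> w \<otimes> h) - u (x \<otimes> h)\<bar> \<le> \<eta>" if h: "h \<in> H" for h
      proof -
        have "x \<otimes> w \<otimes> h = x \<otimes> h \<otimes> w" using x wc h Hc by (auto simp: m_ac)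
        then show ?thesis using w xh[OF x h] by (simp add: almost_periods_def)
      qed
      have "\<phi> (x \<otimes> w) \<le> \<phi> x + \<eta>"
      proof (rule \<phi>_le)
        fix h assume h: "h \<in> H"
        show "u (x \<otimes> w \<otimes> h) \<le> \<phi> x + \<eta>"
          using close[OF h] \<phi>_ge[OF x h] by linarith
      qed
      moreover have "\<phi> x \<le> \<phi> (x \<otimes> w) + \<eta>"
      proof (rule \<phi>_le)
        fix h assume h: "h \<in> H"
        show "u (x \<otimes> h) \<le> \<phi> (x \<otimes> w) + \<eta>"
          using close[OF h] \<phi>_ge[OF _ h, of "x \<otimes> w"] x wc by simp
      qed
      ultimately show ?thesis by linarith
    qed
    then show "w \<in> almost_periods G \<phi> \<eta>" using wc by (simp add: almost_periods_def)
  qed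
  show thesis
  proof (rule that[of \<phi>])
    show "0 \<le> \<phi> x \<and> \<phi> x \<le> 1" if "x \<in> carrier G" for x using bounds[OF that] .
    have "\<phi> \<one> \<le> 0" using Hc uH by (intro \<phi>_le) auto
    then show "\<phi> \<one> = 0" using bounds[of \<one>] by simp
    have "\<phi> g \<ge> 1" using \<phi>_ge[OF g(1) H1] u(3) g(1) by simp
    then show "\<phi> g = 1" using bounds[OF g(1)] by simp
    show "\<exists>U. openin T U \<and> \<one> \<in> U \<and> U \<subseteq> almost_periods G \<phi> \<eta>" if \<eta>: "\<eta> > 0" for \<eta>
      by (rule ex_nbhd_almost_periods[OF uc \<eta>]) (use sub in blast)
    show "H \<subseteq> almost_periods G \<phi> 0"
      using Hc by (auto simp: almost_periods_def \<phi>_def SUP_over_subgroup_translate[OF H])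
  qed
qed

lemma continuous_map_if_almost_periods:
  fixes f :: "'a \<Rightarrow> complex"
  assumes nbhd: "\<And>\<eta>. \<eta> > 0 \<Longrightarrow> \<exists>U. openin T U \<and> \<one> \<in> U \<and> U \<subseteq> A \<eta>"
    and f: "\<And>\<eta> w x. w \<in> A \<eta> \<Longrightarrow> x \<in> carrier G \<Longrightarrow> cmod (f (x \<otimes> w) - f x) \<le> \<eta>"
  shows "continuous_map T euclidean f"
proof -
  have "\<exists>V. openin T V \<and> x \<in> V \<and> (\<forall>y\<in>V. f y \<in> ball (f x) \<epsilon>)"
    if x: "x \<in> topspace T" and \<epsilon>: "\<epsilon> > 0" for x \<epsilon>
  proof -
    have xc: "x \<in> carrier G" using x by (simp add: topspace_eq)
    obtain U where U: "openin T U" "\<one> \<in> U" "U \<subseteq> A (\<epsilon> / 2)" using nbhd[of "\<epsilon> / 2"] \<epsilon> by auto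
    let ?V = "{y \<in> topspace T. y \<otimes> inv x \<in> U}"
    have "openin T ?V"
      using xc by (intro openin_continuous_map_preimage[OF continuous_map_mult_right U(1)]) simp
    moreover have "x \<in> ?V" using x xc U(2) by simp
    moreover have "f y \<in> ball (f x) \<epsilon>" if y: "y \<in> ?V" for y
    proof -
      have yc: "y \<in> carrier G" using y by (simp add: topspace_eq)
      have "y \<otimes> inv x \<in> A (\<epsilon> / 2)" using y U(3) by blast
      from f[OF this xc] have "cmod (f (x \<otimes> (y \<otimes> inv x)) - f x) \<le> \<epsilon> / 2" .
      moreover have "x \<otimes> (y \<otimes> inv x) = y"
        using xc yc m_lcomm[of x y "inv x"] by simp
      ultimately show ?thesis using \<epsilon> by (simp add: dist_norm norm_minus_commute)
    qed
    ultimately show ?thesis by blast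
  qed
  then show ?thesis
    by (simp add: Met_TC.continuous_map_to_metric flip: mtopology_is_euclidean)
qed

lemma carrier_dual_iff:
  "\<kappa> \<in> carrier (dual_group G T) \<longleftrightarrow> \<kappa> \<in> extensional (carrier G) \<and>
     (\<forall>x\<in>carrier G. cmod (\<kappa> x) = 1) \<and> (\<forall>x\<in>carrier G. \<forall>y\<in>carrier G. \<kappa> (x \<otimes> y) = \<kappa> x * \<kappa> y) \<and>
     continuous_map T euclidean \<kappa>"
  by (auto simp: dual_group_def circle_group_def circle_topology_def hom_def
      continuous_map_in_subtopology topspace_eq Pi_iff image_subset_iff)

text \<open>
  The approximate characters of the preceding part lie in a product of discs, which is compact for
  the topology of pointwise convergence. The conditions on them are closed, so a cluster point \<open>\<Phi>\<close>
  satisfies \<open>\<Phi> (x \<otimes> a) * \<Phi> y = \<Phi> x * \<Phi> (y \<otimes> a)\<close> exactly and has constant modulus. Then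
  \<open>\<Phi> / \<Phi> \<one>\<close> is a character. It is continuous and trivial on \<open>H\<close> because \<open>\<Phi>\<close> inherits the almost
  periods of \<open>\<phi>\<close>, and it is nontrivial at \<open>g\<close> because \<open>\<Phi> g\<close> and \<open>\<Phi> \<one>\<close> differ by at least \<open>\<delta>\<close>.
\<close>

proposition separating_character:
  assumes H: "subgroup H G" and g: "g \<in> carrier G" "g \<notin> T closure_of H"
  obtains \<kappa> where "\<kappa> \<in> carrier (dual_group G T)" "\<And>h. h \<in> H \<Longrightarrow> \<kappa> h = 1" "\<kappa> g \<noteq> 1"
proof (rule ex_invariant_separating_function[OF H g])
  fix \<phi>
  assume \<phi>: "\<And>x. x \<in> carrier G \<Longrightarrow> 0 \<le> \<phi> x \<and> \<phi> x \<le> 1" "\<phi> \<one> = 0" "\<phi> g = 1"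
    and nbhd: "\<And>\<eta>. \<eta> > 0 \<Longrightarrow> \<exists>U. openin T U \<and> \<one> \<in> U \<and> U \<subseteq> almost_periods G \<phi> \<eta>"
    and H_AP: "H \<subseteq> almost_periods G \<phi> 0"
  interpret almost_periodic G \<phi> by (rule almost_periodicI[OF nbhd])
  obtain \<delta> where \<delta>: "\<delta> > 0" and approx:
    "\<And>F \<epsilon>. finite F \<Longrightarrow> F \<subseteq> carrier G \<Longrightarrow> \<epsilon> > 0 \<Longrightarrow> \<exists>\<Phi> :: 'a \<Rightarrow> complex.
      (\<forall>x\<in>carrier G. cmod (\<Phi> x) \<le> 1) \<and>
      (\<forall>\<eta>. \<forall>w\<in>AP \<eta>. \<forall>x\<in>carrier G. cmod (\<Phi> (x \<otimes> w) - \<Phi> x) \<le> \<eta>) \<and>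
      \<delta> \<le> cmod (\<Phi> g - \<Phi> \<one>) \<and>
      (\<forall>a\<in>F. \<exists>z. cmod z = 1 \<and> (\<forall>x\<in>carrier G. cmod (\<Phi> (x \<otimes> a) - z * \<Phi> x) \<le> \<epsilon>))"
    using approximate_characters[OF \<phi>(1) g(1) \<phi>(2,3)] by blast
  define W :: "('a \<Rightarrow> complex) set" where "W = (\<Pi>\<^sub>E x\<in>UNIV. cball 0 1)"
  have W: "compact W"
  proof -
    have "compactin (product_topology (\<lambda>_. euclidean) UNIV) W"
      unfolding W_def by (subst compactin_PiE) simp
    then show ?thesis by (simp add: euclidean_product_topology)
  qed
  define C :: "'a \<times> real \<Rightarrow> ('a \<Rightarrow> complex) set" where
    "C = (\<lambda>(a, \<epsilon>). {\<Phi>.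
      (\<forall>\<eta> w x. w \<in> AP \<eta> \<longrightarrow> x \<in> carrier G \<longrightarrow> cmod (\<Phi> (x \<otimes> w) - \<Phi> x) \<le> \<eta>) \<and>
      \<delta> \<le> cmod (\<Phi> g - \<Phi> \<one>) \<and>
      (\<forall>x y. x \<in> carrier G \<longrightarrow> y \<in> carrier G \<longrightarrow> cmod (\<Phi> (x \<otimes> a) * \<Phi> y - \<Phi> x * \<Phi> (y \<otimes> a)) \<le> \<epsilon>) \<and>
      (\<forall>x. x \<in> carrier G \<longrightarrow> \<bar>cmod (\<Phi> (x \<otimes> a)) - cmod (\<Phi> x)\<bar> \<le> \<epsilon>)})"
  have closed: "closed (C i)" for i
  proof -
    obtain a \<epsilon> where i: "i = (a, \<epsilon>)" by (cases i)
    show ?thesis unfolding i C_def prod.case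
      by (intro closed_Collect_conj closed_Collect_all closed_Collect_imp open_Collect_const
          closed_Collect_le continuous_intros continuous_on_product_coordinates)
  qed
  have fip: "W \<inter> (\<Inter>i\<in>I. C i) \<noteq> {}" if I: "finite I" "I \<subseteq> carrier G \<times> {0<..}" for I
  proof -
    \<comment> \<open>Comparing both sides of the product equation with \<open>z * \<Phi> x * \<Phi> y\<close> costs \<open>\<epsilon>\<close> twice.\<close>
    define \<epsilon> where "\<epsilon> = Min (insert 1 (snd ` I)) / 2"
    have \<epsilon>: "\<epsilon> > 0" using I by (auto simp: \<epsilon>_def)
    have \<epsilon>_le: "2 * \<epsilon> \<le> snd i" if "i \<in> I" for i using that I(1) by (simp add: \<epsilon>_def)
    have "finite (fst ` I)" "fst ` I \<subseteq> carrier G" using I by auto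
    from approx[OF this \<epsilon>] obtain \<Phi> :: "'a \<Rightarrow> complex" where
      \<Phi>1: "\<And>x. x \<in> carrier G \<Longrightarrow> cmod (\<Phi> x) \<le> 1" and
      \<Phi>2: "\<And>\<eta> w x. w \<in> AP \<eta> \<Longrightarrow> x \<in> carrier G \<Longrightarrow> cmod (\<Phi> (x \<otimes> w) - \<Phi> x) \<le> \<eta>" and
      \<Phi>3: "\<delta> \<le> cmod (\<Phi> g - \<Phi> \<one>)" and
      \<Phi>4: "\<And>a. a \<in> fst ` I \<Longrightarrow> \<exists>z. cmod z = 1 \<and> (\<forall>x\<in>carrier G. cmod (\<Phi> (x \<otimes> a) - z * \<Phi> x) \<le> \<epsilon>)"
      by blast
    define \<Psi> where "\<Psi> = (\<lambda>x. if x \<in> carrier G then \<Phi> x else 0)"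
    have "\<Psi> \<in> W" using \<Phi>1 by (simp add: W_def \<Psi>_def PiE_iff)
    moreover have "\<Psi> \<in> C i" if i: "i \<in> I" for i
    proof -
      obtain a \<epsilon>' where i': "i = (a, \<epsilon>')" by (cases i)
      have a: "a \<in> carrier G" using i i' I by auto
      have le: "2 * \<epsilon> \<le> \<epsilon>'" using \<epsilon>_le[OF i] i' by simp
      obtain z where z: "cmod z = 1" "\<And>x. x \<in> carrier G \<Longrightarrow> cmod (\<Phi> (x \<otimes> a) - z * \<Phi> x) \<le> \<epsilon>"
        using \<Phi>4[of a] i i' by force
      have "cmod (\<Phi> (x \<otimes> a) * \<Phi> y - \<Phi> x * \<Phi> (y \<otimes> a)) \<le> \<epsilon>'"
        if xy: "x \<in> carrier G" "y \<in> carrier G" for x y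
      proof -
        have "\<Phi> (x \<otimes> a) * \<Phi> y - \<Phi> x * \<Phi> (y \<otimes> a) =
            (\<Phi> (x \<otimes> a) - z * \<Phi> x) * \<Phi> y - \<Phi> x * (\<Phi> (y \<otimes> a) - z * \<Phi> y)"
          by (simp add: algebra_simps)
        also have "cmod \<dots> \<le> cmod ((\<Phi> (x \<otimes> a) - z * \<Phi> x) * \<Phi> y) + cmod (\<Phi> x * (\<Phi> (y \<otimes> a) - z * \<Phi> y))"
          by (rule norm_triangle_ineq4)
        also have "\<dots> \<le> \<epsilon> * 1 + 1 * \<epsilon>"
          unfolding norm_mult using z(2) \<Phi>1 xy \<epsilon> by (intro add_mono mult_mono) auto
        finally show ?thesis using le by simp
      qed
      moreover have "\<bar>cmod (\<Phi> (x \<otimes> a)) - cmod (\<Phi> x)\<bar> \<le> \<epsilon>'" if x: "x \<in> carrier G" for x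
      proof -
        have "\<bar>cmod (\<Phi> (x \<otimes> a)) - cmod (z * \<Phi> x)\<bar> \<le> cmod (\<Phi> (x \<otimes> a) - z * \<Phi> x)"
          by (rule norm_triangle_ineq3)
        then show ?thesis using z(2)[OF x] le \<epsilon> by (simp add: norm_mult z(1))
      qed
      ultimately show ?thesis
        using \<Phi>2 \<Phi>3 a g AP_carrier unfolding i' C_def \<Psi>_def by auto
    qed
    ultimately show ?thesis by blast
  qed
  obtain \<Phi> where \<Phi>: "\<And>i. i \<in> carrier G \<times> {0<..} \<Longrightarrow> \<Phi> \<in> C i"
    using compact_imp_fip_image[OF W closed fip] by blast
  have \<Phi>_AP: "cmod (\<Phi> (x \<otimes> w) - \<Phi> x) \<le> \<eta>" if "w \<in> AP \<eta>" "x \<in> carrier G" for w x \<eta>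
    using \<Phi>[of "(\<one>, 1)"] that by (auto simp: C_def)
  have \<Phi>_g: "\<delta> \<le> cmod (\<Phi> g - \<Phi> \<one>)"
    using \<Phi>[of "(\<one>, 1)"] by (auto simp: C_def)
  have \<Phi>_mult: "\<Phi> (x \<otimes> a) * \<Phi> \<one> = \<Phi> x * \<Phi> a" if "x \<in> carrier G" "a \<in> carrier G" for x a
  proof -
    have "cmod (\<Phi> (x \<otimes> a) * \<Phi> \<one> - \<Phi> x * \<Phi> a) \<le> \<epsilon>" if "\<epsilon> > 0" for \<epsilon>
    proof -
      have "\<Phi> \<in> C (a, \<epsilon>)" using \<Phi> \<open>a \<in> carrier G\<close> that by simp
      then have "cmod (\<Phi> (x \<otimes> a) * \<Phi> \<one> - \<Phi> x * \<Phi> (\<one> \<otimes> a)) \<le> \<epsilon>"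
        using \<open>x \<in> carrier G\<close> unfolding C_def by blast
      then show ?thesis using \<open>a \<in> carrier G\<close> by simp
    qed
    then have "cmod (\<Phi> (x \<otimes> a) * \<Phi> \<one> - \<Phi> x * \<Phi> a) \<le> 0" by (rule field_le_epsilon[of _ 0, simplified])
    then show ?thesis by simp
  qed
  have \<Phi>_norm: "cmod (\<Phi> a) = cmod (\<Phi> \<one>)" if a: "a \<in> carrier G" for a
  proof -
    have "\<bar>cmod (\<Phi> a) - cmod (\<Phi> \<one>)\<bar> \<le> \<epsilon>" if "\<epsilon> > 0" for \<epsilon>
    proof -
      have "\<Phi> \<in> C (a, \<epsilon>)" using \<Phi> a that by simp
      then have "\<bar>cmod (\<Phi> (\<one> \<otimes> a)) - cmod (\<Phi> \<one>)\<bar> \<le> \<epsilon>" unfolding C_def by blast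
      then show ?thesis using a by simp
    qed
    then have "\<bar>cmod (\<Phi> a) - cmod (\<Phi> \<one>)\<bar> \<le> 0" by (rule field_le_epsilon[of _ 0, simplified])
    then show ?thesis by simp
  qed
  have nz: "\<Phi> \<one> \<noteq> 0"
  proof
    assume "\<Phi> \<one> = 0"
    then have "\<Phi> g = 0" using \<Phi>_norm[OF g(1)] by simp
    then show False using \<open>\<Phi> \<one> = 0\<close> \<Phi>_g \<delta> by simp
  qed
  define \<kappa> where "\<kappa> = (\<lambda>x\<in>carrier G. \<Phi> x / \<Phi> \<one>)"
  have "continuous_map euclidean euclidean (\<lambda>z. z / \<Phi> \<one>)"
    using nz by (simp add: continuous_map_iff_continuous2 continuous_on_divide)
  from continuous_map_compose[OF continuous_map_if_almost_periods[where A = AP and f = \<Phi>, OF nbhd \<Phi>_AP] this]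
  have "continuous_map T euclidean (\<lambda>x. \<Phi> x / \<Phi> \<one>)" by (simp add: o_def)
  then have "continuous_map T euclidean \<kappa>"
    by (rule continuous_map_eq) (simp add: \<kappa>_def topspace_eq)
  moreover have "cmod (\<kappa> x) = 1" if "x \<in> carrier G" for x
    using that nz \<Phi>_norm[OF that] by (simp add: \<kappa>_def norm_divide)
  moreover have "\<kappa> (x \<otimes> y) = \<kappa> x * \<kappa> y" if xy: "x \<in> carrier G" "y \<in> carrier G" for x y
  proof -
    have "\<Phi> (x \<otimes> y) = \<Phi> x * \<Phi> y / \<Phi> \<one>"
      using \<Phi>_mult[OF xy] nz by (simp add: eq_divide_eq)
    then show ?thesis using xy by (simp add: \<kappa>_def)
  qed
  moreover have "\<kappa> \<in> extensional (carrier G)" by (simp add: \<kappa>_def)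
  ultimately have "\<kappa> \<in> carrier (dual_group G T)"
    unfolding carrier_dual_iff by blast
  moreover have "\<kappa> h = 1" if h: "h \<in> H" for h
  proof -
    have hc: "h \<in> carrier G" using H h by (simp add: subgroup.mem_carrier)
    have "cmod (\<Phi> (\<one> \<otimes> h) - \<Phi> \<one>) \<le> 0" using H_AP h by (intro \<Phi>_AP) auto
    then show ?thesis using hc nz by (simp add: \<kappa>_def)
  qed
  moreover have "\<kappa> g \<noteq> 1"
    using \<Phi>_g \<delta> g(1) nz by (auto simp: \<kappa>_def)
  ultimately show thesis by (rule that)
qed

end

section \<open>Trigonometric polynomials and the double annihilator\<close>

lemma open_coordinate_preimage:
  fixes U :: "'b::topological_space set"
  assumes "open U"
  shows "open {h :: 'i \<Rightarrow> 'b. h i \<in> U}"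
  using open_vimage[OF assms continuous_on_product_coordinates[of i]] by (simp add: vimage_def)

text \<open>
  A product of Hausdorff spaces is Hausdorff. The instances for the two weaker separation classes
  come first because instances have to be declared along the class hierarchy. They make the
  Stone-Weierstrass theorem applicable to subspaces of arbitrary powers of \<open>\<complex>\<close>.
\<close>

instance "fun" :: (type, t0_space) t0_space
proof
  fix f g :: "'a \<Rightarrow> 'b" assume "f \<noteq> g"
  then obtain i where "f i \<noteq> g i" by blast
  then obtain U where "open U" "(f i \<in> U) \<noteq> (g i \<in> U)" using t0_space_class.t0_space by metis
  then show "\<exists>U. open U \<and> \<not> (f \<in> U \<longleftrightarrow> g \<in> U)"
    by (intro exI[of _ "{h. h i \<in> U}"]) (simp add: open_coordinate_preimage)
qed

instance "fun" :: (type, t1_space) t1_space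
proof
  fix f g :: "'a \<Rightarrow> 'b" assume "f \<noteq> g"
  then obtain i where "f i \<noteq> g i" by blast
  then obtain U where "open U" "f i \<in> U" "g i \<notin> U" using t1_space_class.t1_space by metis
  then show "\<exists>U. open U \<and> f \<in> U \<and> g \<notin> U"
    by (intro exI[of _ "{h. h i \<in> U}"]) (simp add: open_coordinate_preimage)
qed

instance "fun" :: (type, t2_space) t2_space
proof
  fix f g :: "'a \<Rightarrow> 'b" assume "f \<noteq> g"
  then obtain i where "f i \<noteq> g i" by blast
  then obtain U V where "open U" "open V" "f i \<in> U" "g i \<in> V" "U \<inter> V = {}"
    by (metis hausdorff)
  then show "\<exists>U V. open U \<and> open V \<and> f \<in> U \<and> g \<in> V \<and> U \<inter> V = {}"
    by (intro exI[of _ "{h. h i \<in> U}"] exI[of _ "{h. h i \<in> V}"])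
      (auto simp: open_coordinate_preimage)
qed

context compact_abelian_group
begin

abbreviation "D \<equiv> dual_group G T"

lemma dual_mult [simp]: "x \<in> carrier G \<Longrightarrow> (\<alpha> \<otimes>\<^bsub>D\<^esub> \<beta>) x = \<alpha> x * \<beta> x"
  by (simp add: dual_group_def circle_group_def)

lemma dual_one [simp]: "x \<in> carrier G \<Longrightarrow> \<one>\<^bsub>D\<^esub> x = 1"
  by (simp add: dual_group_def circle_group_def)

lemma dual_eqI:
  assumes "\<alpha> \<in> carrier D" "\<beta> \<in> carrier D" "\<And>x. x \<in> carrier G \<Longrightarrow> \<alpha> x = \<beta> x"
  shows "\<alpha> = \<beta>"
  using assms by (intro extensionalityI[of _ "carrier G"]) (auto simp: carrier_dual_iff)

lemma norm_character: "\<alpha> \<in> carrier D \<Longrightarrow> x \<in> carrier G \<Longrightarrow> cmod (\<alpha> x) = 1"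
  by (simp add: carrier_dual_iff)

lemma character_mult:
  "\<alpha> \<in> carrier D \<Longrightarrow> x \<in> carrier G \<Longrightarrow> y \<in> carrier G \<Longrightarrow> \<alpha> (x \<otimes> y) = \<alpha> x * \<alpha> y"
  by (simp add: carrier_dual_iff)

lemma character_continuous: "\<alpha> \<in> carrier D \<Longrightarrow> continuous_map T euclidean \<alpha>"
  by (simp add: carrier_dual_iff)

lemma cnj_character_cancel: "\<alpha> \<in> carrier D \<Longrightarrow> x \<in> carrier G \<Longrightarrow> cnj (\<alpha> x) * \<alpha> x = 1"
  using norm_character[of \<alpha> x] by (metis complex_norm_square mult.commute of_real_1 one_power2)

lemma character_one: "\<alpha> \<in> carrier D \<Longrightarrow> \<alpha> \<one> = 1"
  using character_mult[of \<alpha> \<one> \<one>] norm_character[of \<alpha> \<one>] by auto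

lemma character_inv:
  assumes "\<alpha> \<in> carrier D" "x \<in> carrier G"
  shows "\<alpha> (inv x) = cnj (\<alpha> x)"
proof -
  have "\<alpha> x * \<alpha> (inv x) = 1"
    using character_mult[OF assms(1,2), of "inv x"] character_one[OF assms(1)] assms by simp
  then have "cnj (\<alpha> x) * (\<alpha> x * \<alpha> (inv x)) = cnj (\<alpha> x)" by simp
  then show ?thesis using cnj_character_cancel[OF assms] by (simp add: mult.assoc[symmetric])
qed

lemma conjugate_character:
  assumes "\<alpha> \<in> carrier D"
  shows "(\<lambda>x\<in>carrier G. cnj (\<alpha> x)) \<in> carrier D"
proof -
  have "continuous_map euclidean euclidean cnj"
    by (simp add: continuous_map_iff_continuous2 continuous_on_cnj)
  from continuous_map_compose[OF character_continuous[OF assms] this]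
  have "continuous_map T euclidean (\<lambda>x. cnj (\<alpha> x))" by (simp add: o_def)
  then have "continuous_map T euclidean (\<lambda>x\<in>carrier G. cnj (\<alpha> x))"
    by (rule continuous_map_eq) (simp add: topspace_eq)
  then show ?thesis using assms by (simp add: carrier_dual_iff)
qed

lemma comm_group_dual: "comm_group D"
proof (rule comm_groupI)
  fix \<alpha> \<beta> assume ab: "\<alpha> \<in> carrier D" "\<beta> \<in> carrier D"
  have "continuous_map T (prod_topology euclidean euclidean) (\<lambda>x. (\<alpha> x, \<beta> x))"
    using ab by (intro continuous_map_pairedI character_continuous)
  moreover have "continuous_map (prod_topology euclidean euclidean) euclidean (\<lambda>(z, w). z * w :: complex)"
    by (simp add: continuous_map_iff_continuous2 case_prod_unfold continuous_on_mult continuous_on_fst continuous_on_snd)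
  ultimately have "continuous_map T euclidean ((\<lambda>(z, w). z * w) \<circ> (\<lambda>x. (\<alpha> x, \<beta> x)))"
    by (rule continuous_map_compose)
  then have "continuous_map T euclidean (\<lambda>x. \<alpha> x * \<beta> x)" by (simp add: o_def)
  then have "continuous_map T euclidean (\<alpha> \<otimes>\<^bsub>D\<^esub> \<beta>)"
    by (rule continuous_map_eq) (simp add: topspace_eq)
  moreover have "\<alpha> \<otimes>\<^bsub>D\<^esub> \<beta> \<in> extensional (carrier G)" by (simp add: dual_group_def)
  ultimately show "\<alpha> \<otimes>\<^bsub>D\<^esub> \<beta> \<in> carrier D"
    using ab by (simp add: carrier_dual_iff norm_mult mult_ac)
next
  have "continuous_map T euclidean (\<lambda>x. 1 :: complex)" by simp
  then have "continuous_map T euclidean \<one>\<^bsub>D\<^esub>"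
    by (rule continuous_map_eq) (simp add: topspace_eq)
  moreover have "\<one>\<^bsub>D\<^esub> \<in> extensional (carrier G)" by (simp add: dual_group_def)
  ultimately show "\<one>\<^bsub>D\<^esub> \<in> carrier D" by (simp add: carrier_dual_iff)
next
  fix \<alpha> assume a: "\<alpha> \<in> carrier D"
  show "\<exists>\<beta>\<in>carrier D. \<beta> \<otimes>\<^bsub>D\<^esub> \<alpha> = \<one>\<^bsub>D\<^esub>"
    using conjugate_character[OF a] cnj_character_cancel[OF a]
    by (intro bexI[of _ "\<lambda>x\<in>carrier G. cnj (\<alpha> x)"])
      (auto simp: dual_group_def circle_group_def)
  show "\<one>\<^bsub>D\<^esub> \<otimes>\<^bsub>D\<^esub> \<alpha> = \<alpha>"
    using a by (intro extensionalityI[of _ "carrier G"]) (auto simp: carrier_dual_iff, auto simp: dual_group_def)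
qed (auto simp: dual_group_def circle_group_def mult_ac)

sublocale dual: comm_group D
  by (rule comm_group_dual)

lemma dual_inv: "\<alpha> \<in> carrier D \<Longrightarrow> x \<in> carrier G \<Longrightarrow> (inv\<^bsub>D\<^esub> \<alpha>) x = cnj (\<alpha> x)"
proof -
  assume a: "\<alpha> \<in> carrier D" "x \<in> carrier G"
  have "(inv\<^bsub>D\<^esub> \<alpha>) = (\<lambda>x\<in>carrier G. cnj (\<alpha> x))"
    using a(1) conjugate_character[OF a(1)] cnj_character_cancel[OF a(1)]
    by (intro dual.inv_equality) (auto simp: dual_group_def circle_group_def)
  then show ?thesis using a by simp
qed

end

text \<open>
  Linear combinations of the functions in \<open>\<Gamma>\<close>, taken up to equality on \<open>X\<close>. Values outside of \<open>X\<close> have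
  to be disregarded because the product of two characters is undefined there.
\<close>

inductive_set trig_polynomials :: "'a set \<Rightarrow> ('a \<Rightarrow> complex) set \<Rightarrow> ('a \<Rightarrow> complex) set"
  for X :: "'a set" and \<Gamma> :: "('a \<Rightarrow> complex) set" where
  char: "\<gamma> \<in> \<Gamma> \<Longrightarrow> \<gamma> \<in> trig_polynomials X \<Gamma>"
| add: "f \<in> trig_polynomials X \<Gamma> \<Longrightarrow> g \<in> trig_polynomials X \<Gamma> \<Longrightarrow> (\<lambda>x. f x + g x) \<in> trig_polynomials X \<Gamma>"
| scale: "f \<in> trig_polynomials X \<Gamma> \<Longrightarrow> (\<lambda>x. c * f x) \<in> trig_polynomials X \<Gamma>"
| cong: "f \<in> trig_polynomials X \<Gamma> \<Longrightarrow> (\<And>x. x \<in> X \<Longrightarrow> g x = f x) \<Longrightarrow> g \<in> trig_polynomials X \<Gamma>"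

lemma trig_polynomials_mult:
  assumes closed: "\<And>\<gamma> \<delta>. \<gamma> \<in> \<Gamma> \<Longrightarrow> \<delta> \<in> \<Gamma> \<Longrightarrow> \<exists>\<epsilon>\<in>\<Gamma>. \<forall>x\<in>X. \<epsilon> x = \<gamma> x * \<delta> x"
    and "f \<in> trig_polynomials X \<Gamma>" "g \<in> trig_polynomials X \<Gamma>"
  shows "(\<lambda>x. f x * g x) \<in> trig_polynomials X \<Gamma>"
proof -
  have char_mult: "(\<lambda>x. \<gamma> x * g x) \<in> trig_polynomials X \<Gamma>" if \<gamma>: "\<gamma> \<in> \<Gamma>" for \<gamma>
    using assms(3)
  proof (induction rule: trig_polynomials.induct)
    case (char \<delta>)
    then obtain \<epsilon> where "\<epsilon> \<in> \<Gamma>" "\<And>x. x \<in> X \<Longrightarrow> \<gamma> x * \<delta> x = \<epsilon> x" using closed[OF \<gamma>] by metis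
    then show ?case by (meson trig_polynomials.char trig_polynomials.cong)
  next
    case (add f g)
    from trig_polynomials.add[OF add.IH] show ?case by (simp add: ring_distribs)
  next
    case (scale f c)
    from trig_polynomials.scale[OF scale.IH, of c] show ?case by (simp add: mult_ac)
  next
    case (cong f g)
    then show ?case by (intro trig_polynomials.cong[OF cong.IH]) simp
  qed
  show ?thesis using assms(2)
  proof (induction rule: trig_polynomials.induct)
    case (char \<gamma>)
    then show ?case by (rule char_mult)
  next
    case (add f h)
    from trig_polynomials.add[OF add.IH] show ?case by (simp add: ring_distribs)
  next
    case (scale f c)
    from trig_polynomials.scale[OF scale.IH, of c] show ?case by (simp add: mult_ac)
  next
    case (cong f h)
    then show ?case by (intro trig_polynomials.cong[OF cong.IH]) simp
  qed
qed

lemma norm_sum_list_le: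
  fixes f :: "'x \<Rightarrow> 'y :: real_normed_vector" and c :: real
  shows "(\<And>t. t \<in> set ts \<Longrightarrow> norm (f t) \<le> c) \<Longrightarrow> norm (\<Sum>t\<leftarrow>ts. f t) \<le> c * length ts"
proof (induction ts)
  case (Cons t ts)
  then have "norm (f t) \<le> c" "norm (\<Sum>t\<leftarrow>ts. f t) \<le> c * length ts" by auto
  then have "norm (f t + (\<Sum>t\<leftarrow>ts. f t)) \<le> c + c * length ts"
    using norm_triangle_ineq[of "f t" "\<Sum>t\<leftarrow>ts. f t"] by linarith
  then show ?case by (simp add: algebra_simps)
qed simp

lemma sum_list_product: "(\<Sum>p\<leftarrow>List.product xs ys. h (fst p) (snd p)) = (\<Sum>x\<leftarrow>xs. \<Sum>y\<leftarrow>ys. h x y)"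
  by (induction xs) (auto simp: o_def)

lemma sum_list_swap:
  fixes h :: "'x \<Rightarrow> 'y \<Rightarrow> 'z :: comm_monoid_add"
  shows "(\<Sum>x\<leftarrow>xs. \<Sum>y\<leftarrow>ys. h x y) = (\<Sum>y\<leftarrow>ys. \<Sum>x\<leftarrow>xs. h x y)"
  by (induction xs) (auto simp: sum_list_addf)

context compact_abelian_group
begin

text \<open>
  A substitute for a vanishing Haar integral: finite averages of translates of \<open>f\<close> become uniformly
  small. This gives the orthogonality relations for characters without an invariant measure.
\<close>

definition null_mean :: "('a \<Rightarrow> complex) \<Rightarrow> bool" where
  "null_mean f \<longleftrightarrow> (\<forall>\<epsilon>>0::real. \<exists>ts. ts \<noteq> [] \<and> set ts \<subseteq> carrier G \<and>
     (\<forall>x\<in>carrier G. cmod (\<Sum>t\<leftarrow>ts. f (x \<otimes> t)) \<le> \<epsilon> * length ts))"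

lemma null_meanE:
  fixes \<epsilon> :: real
  assumes "null_mean f" "\<epsilon> > 0"
  obtains ts where "ts \<noteq> []" "set ts \<subseteq> carrier G"
    "\<And>x. x \<in> carrier G \<Longrightarrow> cmod (\<Sum>t\<leftarrow>ts. f (x \<otimes> t)) \<le> \<epsilon> * length ts"
proof -
  have "\<exists>ts. ts \<noteq> [] \<and> set ts \<subseteq> carrier G \<and>
     (\<forall>x\<in>carrier G. cmod (\<Sum>t\<leftarrow>ts. f (x \<otimes> t)) \<le> \<epsilon> * length ts)"
    using assms by (simp add: null_mean_def)
  then show thesis using that by (elim exE conjE) simp
qed

text \<open>
  Average over the first powers of an element \<open>a\<close> with \<open>\<kappa> a \<noteq> 1\<close> and sum the geometric series.
\<close>

lemma null_mean_character:
  assumes \<kappa>: "\<kappa> \<in> carrier D" "\<kappa> \<noteq> \<one>\<^bsub>D\<^esub>"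
  shows "null_mean \<kappa>"
  unfolding null_mean_def
proof (intro allI impI)
  fix \<epsilon> :: real assume \<epsilon>: "\<epsilon> > 0"
  obtain a where a: "a \<in> carrier G" "\<kappa> a \<noteq> 1"
    using dual_eqI[OF \<kappa>(1) dual.one_closed] \<kappa>(2) by auto
  define z where "z = \<kappa> a"
  have z: "cmod z = 1" "z \<noteq> 1" using a norm_character[OF \<kappa>(1)] by (auto simp: z_def)
  obtain N where N: "2 / (\<epsilon> * cmod (z - 1)) < real N" using reals_Archimedean2 by blast
  have pos: "\<epsilon> * cmod (z - 1) > 0" using \<epsilon> z by simp
  have N0: "N > 0" using N pos by (metis divide_pos_pos gr0I of_nat_0 order_less_trans order_less_irrefl zero_less_numeral)
  have pow: "\<kappa> (a [^] n) = z ^ n" for n :: nat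
    using a by (induction n) (auto simp: character_one[OF \<kappa>(1)] character_mult[OF \<kappa>(1)] z_def)
  show "\<exists>ts. ts \<noteq> [] \<and> set ts \<subseteq> carrier G \<and>
     (\<forall>x\<in>carrier G. cmod (\<Sum>t\<leftarrow>ts. \<kappa> (x \<otimes> t)) \<le> \<epsilon> * length ts)"
  proof (intro exI[of _ "map (\<lambda>n. a [^] n) [0..<N]"] conjI ballI)
    show "map (\<lambda>n. a [^] n) [0..<N] \<noteq> []" using N0 by simp
    show "set (map (\<lambda>n. a [^] n) [0..<N]) \<subseteq> carrier G" using a by auto
    fix x assume x: "x \<in> carrier G"
    have "(\<Sum>t\<leftarrow>map (\<lambda>n. a [^] n) [0..<N]. \<kappa> (x \<otimes> t)) = (\<Sum>n<N. \<kappa> x * z ^ n)"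
      using x a by (simp add: o_def character_mult[OF \<kappa>(1)] pow interv_sum_list_conv_sum_set_nat atLeast0LessThan)
    also have "\<dots> = \<kappa> x * ((z ^ N - 1) / (z - 1))"
      using z by (simp add: sum_distrib_left[symmetric] geometric_sum)
    also have "cmod \<dots> = cmod (z ^ N - 1) / cmod (z - 1)"
      using norm_character[OF \<kappa>(1) x] by (simp add: norm_mult norm_divide)
    also have "\<dots> \<le> 2 / cmod (z - 1)"
    proof (rule divide_right_mono)
      show "cmod (z ^ N - 1) \<le> 2"
        using norm_triangle_ineq4[of "z ^ N" 1] z by (simp add: norm_power)
    qed simp
    also have "\<dots> \<le> \<epsilon> * N" using N pos \<epsilon> z by (simp add: field_simps)
    finally show "cmod (\<Sum>t\<leftarrow>map (\<lambda>n. a [^] n) [0..<N]. \<kappa> (x \<otimes> t)) \<le>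
        \<epsilon> * length (map (\<lambda>n. a [^] n) [0..<N])" by simp
  qed
qed

lemma null_mean_scale:
  assumes "null_mean f"
  shows "null_mean (\<lambda>x. c * f x)"
  unfolding null_mean_def
proof (intro allI impI)
  fix \<epsilon> :: real assume \<epsilon>: "\<epsilon> > 0"
  then have "\<epsilon> / (cmod c + 1) > 0" by (simp add: add_nonneg_pos)
  from null_meanE[OF assms this] obtain ts where ts: "ts \<noteq> []" "set ts \<subseteq> carrier G"
    "\<And>x. x \<in> carrier G \<Longrightarrow> cmod (\<Sum>t\<leftarrow>ts. f (x \<otimes> t)) \<le> \<epsilon> / (cmod c + 1) * length ts" by metis
  have "cmod (\<Sum>t\<leftarrow>ts. c * f (x \<otimes> t)) \<le> \<epsilon> * length ts" if x: "x \<in> carrier G" for x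
  proof -
    have "cmod (\<Sum>t\<leftarrow>ts. c * f (x \<otimes> t)) = cmod c * cmod (\<Sum>t\<leftarrow>ts. f (x \<otimes> t))"
      by (simp add: sum_list_const_mult norm_mult)
    also have "\<dots> \<le> (cmod c + 1) * (\<epsilon> / (cmod c + 1) * length ts)"
      using ts(3)[OF x] by (intro mult_mono) auto
    also have "\<dots> = \<epsilon> * length ts"
      by (simp add: add_nonneg_eq_0_iff)
    finally show ?thesis .
  qed
  then show "\<exists>ts. ts \<noteq> [] \<and> set ts \<subseteq> carrier G \<and>
     (\<forall>x\<in>carrier G. cmod (\<Sum>t\<leftarrow>ts. c * f (x \<otimes> t)) \<le> \<epsilon> * length ts)" using ts by blast
qed

text \<open>
  The products of the translations that average out \<open>f\<close> with those that average out \<open>g\<close> do both at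
  once.
\<close>

lemma null_mean_add:
  assumes "null_mean f" "null_mean g"
  shows "null_mean (\<lambda>x. f x + g x)"
  unfolding null_mean_def
proof (intro allI impI)
  fix \<epsilon> :: real assume "\<epsilon> > 0"
  then have \<epsilon>: "\<epsilon> / 2 > 0" by simp
  obtain ts where ts: "ts \<noteq> []" "set ts \<subseteq> carrier G"
    "\<And>x. x \<in> carrier G \<Longrightarrow> cmod (\<Sum>t\<leftarrow>ts. f (x \<otimes> t)) \<le> \<epsilon> / 2 * length ts"
    using null_meanE[OF assms(1) \<epsilon>] by metis
  obtain ss where ss: "ss \<noteq> []" "set ss \<subseteq> carrier G"
    "\<And>x. x \<in> carrier G \<Longrightarrow> cmod (\<Sum>s\<leftarrow>ss. g (x \<otimes> s)) \<le> \<epsilon> / 2 * length ss"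
    using null_meanE[OF assms(2) \<epsilon>] by metis
  define rs where "rs = map (\<lambda>p. fst p \<otimes> snd p) (List.product ts ss)"
  have sum_rs: "(\<Sum>r\<leftarrow>rs. h (x \<otimes> r)) = (\<Sum>t\<leftarrow>ts. \<Sum>s\<leftarrow>ss. h (x \<otimes> (t \<otimes> s)))"
    for h :: "'a \<Rightarrow> complex" and x
    using sum_list_product[of "\<lambda>t s. h (x \<otimes> (t \<otimes> s))" ts ss] by (simp add: rs_def o_def)
  have len: "length rs = length ts * length ss" by (simp add: rs_def)
  have "cmod (\<Sum>r\<leftarrow>rs. f (x \<otimes> r) + g (x \<otimes> r)) \<le> \<epsilon> * length rs" if x: "x \<in> carrier G" for x
  proof -
    have "(\<Sum>r\<leftarrow>rs. f (x \<otimes> r)) = (\<Sum>s\<leftarrow>ss. \<Sum>t\<leftarrow>ts. f (x \<otimes> (t \<otimes> s)))"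
      unfolding sum_rs by (rule sum_list_swap)
    also have "cmod \<dots> \<le> (\<epsilon> / 2 * length ts) * length ss"
    proof (rule norm_sum_list_le)
      fix s assume "s \<in> set ss"
      then have s: "s \<in> carrier G" using ss by auto
      have "(\<Sum>t\<leftarrow>ts. f (x \<otimes> (t \<otimes> s))) = (\<Sum>t\<leftarrow>ts. f (x \<otimes> s \<otimes> t))"
        using s x ts(2) by (intro arg_cong[where f = sum_list] map_cong refl) (auto simp: m_ac)
      then show "cmod (\<Sum>t\<leftarrow>ts. f (x \<otimes> (t \<otimes> s))) \<le> \<epsilon> / 2 * length ts"
        using ts(3)[of "x \<otimes> s"] s x by simp
    qed
    finally have 1: "cmod (\<Sum>r\<leftarrow>rs. f (x \<otimes> r)) \<le> (\<epsilon> / 2 * length ts) * length ss" .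
    have 2: "cmod (\<Sum>r\<leftarrow>rs. g (x \<otimes> r)) \<le> (\<epsilon> / 2 * length ss) * length ts"
      unfolding sum_rs
    proof (rule norm_sum_list_le)
      fix t assume "t \<in> set ts"
      then have t: "t \<in> carrier G" using ts by auto
      have "(\<Sum>s\<leftarrow>ss. g (x \<otimes> (t \<otimes> s))) = (\<Sum>s\<leftarrow>ss. g (x \<otimes> t \<otimes> s))"
        using t x ss(2) by (intro arg_cong[where f = sum_list] map_cong refl) (auto simp: m_assoc)
      then show "cmod (\<Sum>s\<leftarrow>ss. g (x \<otimes> (t \<otimes> s))) \<le> \<epsilon> / 2 * length ss"
        using ss(3)[of "x \<otimes> t"] t x by simp
    qed
    have "cmod (\<Sum>r\<leftarrow>rs. f (x \<otimes> r) + g (x \<otimes> r)) \<le>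
        cmod (\<Sum>r\<leftarrow>rs. f (x \<otimes> r)) + cmod (\<Sum>r\<leftarrow>rs. g (x \<otimes> r))"
      unfolding sum_list_addf by (rule norm_triangle_ineq)
    also have "\<dots> \<le> (\<epsilon> / 2 * length ts) * length ss + (\<epsilon> / 2 * length ss) * length ts"
      using 1 2 by (rule add_mono)
    also have "\<dots> = \<epsilon> * length rs" by (simp add: len)
    finally show ?thesis .
  qed
  moreover have "rs \<noteq> []" using ts ss by (metis len length_0_conv mult_is_0)
  moreover have "set rs \<subseteq> carrier G" using subsetD[OF ts(2)] subsetD[OF ss(2)] by (auto simp: rs_def)
  ultimately show "\<exists>rs. rs \<noteq> [] \<and> set rs \<subseteq> carrier G \<and>
     (\<forall>x\<in>carrier G. cmod (\<Sum>r\<leftarrow>rs. f (x \<otimes> r) + g (x \<otimes> r)) \<le> \<epsilon> * length rs)" by blast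
qed

lemma null_mean_cong:
  assumes "null_mean f" "\<And>x. x \<in> carrier G \<Longrightarrow> g x = f x"
  shows "null_mean g"
  unfolding null_mean_def
proof (intro allI impI)
  fix \<epsilon> :: real assume "\<epsilon> > 0"
  from null_meanE[OF assms(1) this] obtain ts where ts: "ts \<noteq> []" "set ts \<subseteq> carrier G"
    "\<And>x. x \<in> carrier G \<Longrightarrow> cmod (\<Sum>t\<leftarrow>ts. f (x \<otimes> t)) \<le> \<epsilon> * length ts" by metis
  have "(\<Sum>t\<leftarrow>ts. g (x \<otimes> t)) = (\<Sum>t\<leftarrow>ts. f (x \<otimes> t))" if "x \<in> carrier G" for x
    using assms(2) that ts(2) by (intro arg_cong[where f = sum_list] map_cong refl) auto
  then show "\<exists>ts. ts \<noteq> [] \<and> set ts \<subseteq> carrier G \<and>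
     (\<forall>x\<in>carrier G. cmod (\<Sum>t\<leftarrow>ts. g (x \<otimes> t)) \<le> \<epsilon> * length ts)" using ts by auto
qed

lemma not_null_mean_near_one:
  assumes "null_mean f" "\<And>x. x \<in> carrier G \<Longrightarrow> cmod (1 - f x) \<le> 1/2"
  shows False
proof -
  have "(1/4 :: real) > 0" by simp
  from null_meanE[OF assms(1) this] obtain ts where ts: "ts \<noteq> []" "set ts \<subseteq> carrier G"
    "\<And>x. x \<in> carrier G \<Longrightarrow> cmod (\<Sum>t\<leftarrow>ts. f (x \<otimes> t)) \<le> 1/4 * length ts" by metis
  define s where "s = (\<Sum>t\<leftarrow>ts. f (\<one> \<otimes> t))"
  have "cmod (\<Sum>t\<leftarrow>ts. 1 - f (\<one> \<otimes> t)) \<le> 1/2 * length ts"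
    using assms(2) ts(2) by (intro norm_sum_list_le) auto
  then have "cmod (of_nat (length ts) - s) \<le> 1/2 * length ts"
    by (simp add: s_def sum_list_subtractf sum_list_triv)
  moreover have "cmod s \<le> 1/4 * length ts" using ts(3)[OF one_closed] by (simp add: s_def)
  moreover have "real (length ts) \<le> cmod (of_nat (length ts) - s) + cmod s"
    using norm_triangle_ineq[of "of_nat (length ts) - s" s] by simp
  ultimately have "real (length ts) \<le> 0" by linarith
  then show False using ts(1) by simp
qed

text \<open>
  Suppose that \<open>\<psi>\<close> is not in the subgroup \<open>\<Delta>\<close> generated by \<open>S\<close>. As \<open>\<psi>\<close> is trivial wherever \<open>\<Delta>\<close> is,
  \<open>\<Delta>\<close> separates the points of the compact image of \<open>G\<close> under the evaluation map with coordinates \<open>\<psi>\<close>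
  and \<open>\<Delta>\<close>. By the Stone-Weierstrass theorem the coordinate \<open>\<psi>\<close> is uniformly close to a linear
  combination \<open>t\<close> of elements of \<open>\<Delta>\<close>. But \<open>cnj \<psi> * t\<close> is a combination of nontrivial characters and
  averages out, whereas it stays close to \<open>1\<close>.
\<close>

proposition double_annihilator:
  assumes S: "S \<subseteq> carrier D" and \<psi>: "\<psi> \<in> carrier D"
    and ann: "\<And>x. x \<in> carrier G \<Longrightarrow> (\<And>\<gamma>. \<gamma> \<in> S \<Longrightarrow> \<gamma> x = 1) \<Longrightarrow> \<psi> x = 1"
  shows "\<psi> \<in> generate D S"
proof (rule ccontr)
  let ?\<Delta> = "generate D S"
  let ?P = "trig_polynomials (carrier G) ?\<Delta>"
  assume not_in: "\<psi> \<notin> ?\<Delta>"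
  have \<Delta>c: "\<gamma> \<in> carrier D" if "\<gamma> \<in> ?\<Delta>" for \<gamma>
    using that dual.generate_in_carrier[OF S] by blast
  \<comment> \<open>Including \<open>\<psi>\<close> among the coordinates makes it a continuous function on the image for free.\<close>
  define \<iota> where "\<iota> = (\<lambda>x \<gamma>. if \<gamma> \<in> insert \<psi> ?\<Delta> then \<gamma> x else (0::complex))"
  have "continuous_map T (product_topology (\<lambda>_. euclidean) UNIV) \<iota>"
    unfolding continuous_map_componentwise_UNIV
  proof
    fix \<gamma>
    show "continuous_map T euclidean (\<lambda>x. \<iota> x \<gamma>)"
      using \<psi> \<Delta>c character_continuous by (cases "\<gamma> \<in> insert \<psi> ?\<Delta>") (auto simp: \<iota>_def)
  qed
  then have cont: "continuous_map T euclidean \<iota>" by (simp add: euclidean_product_topology)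
  define X where "X = \<iota> ` carrier G"
  have "compactin T (carrier G)" using compact by (simp add: compact_space_def topspace_eq)
  from image_compactin[OF this cont] have X: "compact X" by (simp add: X_def)
  define R where "R = {f. continuous_on X f \<and> (\<lambda>x. complex_of_real (f (\<iota> x))) \<in> ?P}"
  have one_P: "(\<lambda>x. 1) \<in> ?P"
    by (rule trig_polynomials.cong[OF trig_polynomials.char[OF generate.one]]) simp
  have const_P: "(\<lambda>x. c) \<in> ?P" for c :: complex
    using trig_polynomials.scale[OF one_P, of c] by simp
  have mult_P: "(\<lambda>x. f x * h x) \<in> ?P" if "f \<in> ?P" "h \<in> ?P" for f h
    using trig_polynomials_mult[OF _ that] generate.eng by (metis dual_mult)
  have coord: "continuous_on X (\<lambda>p. p \<gamma>)" for \<gamma> :: "'a \<Rightarrow> complex"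
    by (rule continuous_on_subset[OF continuous_on_product_coordinates]) simp
  have cnj_P: "(\<lambda>x. cnj (\<gamma> x)) \<in> ?P" if \<gamma>: "\<gamma> \<in> ?\<Delta>" for \<gamma>
    by (rule trig_polynomials.cong[OF trig_polynomials.char[OF dual.generate_m_inv_closed[OF S \<gamma>]]])
      (simp add: dual_inv[OF \<Delta>c[OF \<gamma>]])
  interpret R: function_ring_on R X
  proof
    show "compact X" by (rule X)
    show "continuous_on X f" if "f \<in> R" for f using that by (simp add: R_def)
    show "(\<lambda>x. f x + h x) \<in> R" if "f \<in> R" "h \<in> R" for f h
      using that trig_polynomials.add[of "\<lambda>x. complex_of_real (f (\<iota> x))" _ _ "\<lambda>x. complex_of_real (h (\<iota> x))"]
      by (auto simp: R_def intro: continuous_on_add)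
    show "(\<lambda>x. f x * h x) \<in> R" if "f \<in> R" "h \<in> R" for f h
      using that mult_P[of "\<lambda>x. complex_of_real (f (\<iota> x))" "\<lambda>x. complex_of_real (h (\<iota> x))"]
      by (auto simp: R_def intro: continuous_on_mult)
    show "(\<lambda>_. c) \<in> R" for c using const_P by (simp add: R_def)
    fix p q assume "p \<in> X" "q \<in> X" "p \<noteq> q"
    then obtain x y where x: "x \<in> carrier G" "p = \<iota> x" and y: "y \<in> carrier G" "q = \<iota> y"
      by (auto simp: X_def)
    have "\<exists>\<gamma>\<in>?\<Delta>. \<gamma> x \<noteq> \<gamma> y"
    proof (rule ccontr)
      assume "\<not> ?thesis"
      then have eq: "\<gamma> x = \<gamma> y" if "\<gamma> \<in> ?\<Delta>" for \<gamma> using that by blast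
      have trans: "\<gamma> (inv y \<otimes> x) = cnj (\<gamma> y) * \<gamma> x" if "\<gamma> \<in> carrier D" for \<gamma>
        using that x y by (simp add: character_mult character_inv)
      have "\<gamma> (inv y \<otimes> x) = 1" if "\<gamma> \<in> S" for \<gamma>
        using that S trans[of \<gamma>] eq[of \<gamma>] cnj_character_cancel[of \<gamma> y] y generate.incl[of \<gamma> S D] by auto
      then have "\<psi> (inv y \<otimes> x) = 1" using x y by (intro ann) auto
      then have "cnj (\<psi> y) * \<psi> x = cnj (\<psi> y) * \<psi> y"
        using trans[OF \<psi>] cnj_character_cancel[OF \<psi> y(1)] by simp
      moreover have "cnj (\<psi> y) \<noteq> 0" using norm_character[OF \<psi> y(1)] by auto
      ultimately have "\<psi> x = \<psi> y" by simp
      then have "\<iota> x = \<iota> y" using eq by (auto simp: \<iota>_def)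
      then show False using \<open>p \<noteq> q\<close> x y by simp
    qed
    then obtain \<gamma> where \<gamma>: "\<gamma> \<in> ?\<Delta>" "\<gamma> x \<noteq> \<gamma> y" by blast
    have \<gamma>P: "\<gamma> \<in> ?P" using \<gamma>(1) by (rule trig_polynomials.char)
    have \<iota>\<gamma>: "\<iota> z \<gamma> = \<gamma> z" for z using \<gamma> by (simp add: \<iota>_def)
    have "(\<lambda>x. (1/2) * (\<gamma> x + cnj (\<gamma> x))) \<in> ?P"
      by (intro trig_polynomials.scale trig_polynomials.add \<gamma>P cnj_P \<gamma>)
    then have "(\<lambda>x. complex_of_real (Re (\<gamma> x))) \<in> ?P" by (simp add: complex_add_cnj)
    then have Re: "(\<lambda>p. Re (p \<gamma>)) \<in> R"
      by (simp add: R_def \<iota>\<gamma> coord continuous_on_Re)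
    have "(\<lambda>x. (-\<i>/2) * (\<gamma> x + (-1) * cnj (\<gamma> x))) \<in> ?P"
      by (intro trig_polynomials.scale trig_polynomials.add \<gamma>P cnj_P \<gamma>)
    then have "(\<lambda>x. complex_of_real (Im (\<gamma> x))) \<in> ?P"
      by (rule trig_polynomials.cong) (simp add: complex_eq_iff)
    then have Im: "(\<lambda>p. Im (p \<gamma>)) \<in> R"
      by (simp add: R_def \<iota>\<gamma> coord continuous_on_Im)
    have "Re (p \<gamma>) \<noteq> Re (q \<gamma>) \<or> Im (p \<gamma>) \<noteq> Im (q \<gamma>)"
      using \<gamma>(2) x y \<iota>\<gamma> by (auto simp: complex_eq_iff)
    then show "\<exists>f\<in>R. f p \<noteq> f q"
    proof
      assume "Re (p \<gamma>) \<noteq> Re (q \<gamma>)"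
      then show ?thesis by (intro bexI[OF _ Re])
    next
      assume "Im (p \<gamma>) \<noteq> Im (q \<gamma>)"
      then show ?thesis by (intro bexI[OF _ Im])
    qed
  qed
  obtain r1 where r1: "r1 \<in> R" "\<And>p. p \<in> X \<Longrightarrow> \<bar>Re (p \<psi>) - r1 p\<bar> < 1/4"
    using R.Stone_Weierstrass_basic[of "\<lambda>p. Re (p \<psi>)" "1/4"] coord continuous_on_Re by force
  obtain r2 where r2: "r2 \<in> R" "\<And>p. p \<in> X \<Longrightarrow> \<bar>Im (p \<psi>) - r2 p\<bar> < 1/4"
    using R.Stone_Weierstrass_basic[of "\<lambda>p. Im (p \<psi>)" "1/4"] coord continuous_on_Im by force
  define t where "t = (\<lambda>x. complex_of_real (r1 (\<iota> x)) + \<i> * complex_of_real (r2 (\<iota> x)))"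
  have "t \<in> ?P" unfolding t_def
    using r1 r2 by (intro trig_polynomials.add trig_polynomials.scale) (auto simp: R_def)
  then have null: "null_mean (\<lambda>x. cnj (\<psi> x) * t x)"
  proof (induction rule: trig_polynomials.induct)
    case (char \<gamma>)
    let ?\<kappa> = "inv\<^bsub>D\<^esub> \<psi> \<otimes>\<^bsub>D\<^esub> \<gamma>"
    have "?\<kappa> \<noteq> \<one>\<^bsub>D\<^esub>"
    proof
      assume "?\<kappa> = \<one>\<^bsub>D\<^esub>"
      then have "\<psi> = \<gamma>" using \<psi> \<Delta>c[OF char]
        by (metis dual.inv_closed dual.inv_equality dual.inv_inv)
      then show False using char not_in by simp
    qed
    then have "null_mean ?\<kappa>" using \<psi> \<Delta>c[OF char] by (intro null_mean_character) auto
    then show ?case by (rule null_mean_cong) (simp add: dual_inv[OF \<psi>])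
  next
    case (add f h)
    from null_mean_add[OF add.IH] show ?case by (simp add: ring_distribs)
  next
    case (scale f c)
    from null_mean_scale[OF scale.IH, of c] show ?case by (simp add: mult_ac)
  next
    case (cong f h)
    then show ?case by (intro null_mean_cong[OF cong.IH]) simp
  qed
  have "cmod (1 - cnj (\<psi> x) * t x) \<le> 1/2" if x: "x \<in> carrier G" for x
  proof -
    have \<iota>\<psi>: "\<iota> x \<psi> = \<psi> x" by (simp add: \<iota>_def)
    have xX: "\<iota> x \<in> X" using x by (simp add: X_def)
    have "1 - cnj (\<psi> x) * t x = cnj (\<psi> x) * (\<psi> x - t x)"
      using cnj_character_cancel[OF \<psi> x] by (simp add: ring_distribs)
    then have "cmod (1 - cnj (\<psi> x) * t x) = cmod (\<psi> x - t x)"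
      using norm_character[OF \<psi> x] by (simp add: norm_mult)
    also have "\<dots> \<le> \<bar>Re (\<psi> x - t x)\<bar> + \<bar>Im (\<psi> x - t x)\<bar>" by (rule cmod_le)
    also have "\<dots> \<le> 1/4 + 1/4"
      using r1(2)[OF xX] r2(2)[OF xX] by (simp add: t_def \<iota>\<psi>)
    finally show ?thesis by simp
  qed
  with null show False by (rule not_null_mean_near_one)
qed

end

section \<open>Countability of the dual group\<close>

context compact_abelian_group
begin

text \<open>
  An uncountable independent set \<open>I\<close> of characters makes the group look like a product over \<open>I\<close>, and
  \<open>H\<close> is the analogue of a \<open>\<Sigma>\<close>-product: the points at which all but countably many members of \<open>I\<close> are
  trivial. A countable subset of \<open>H\<close> is killed by some member of \<open>I\<close>, hence so is its closure, and
  \<open>H\<close> is not separable. If \<open>H\<close> were not dense, some nontrivial \<open>\<psi>\<close> would vanish on it, so \<open>\<psi>\<close> would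
  belong to \<open>\<langle>I - A\<rangle>\<close> for every countable \<open>A\<close>; taking for \<open>A\<close> a finite set whose span contains \<open>\<psi>\<close>
  contradicts independence.
\<close>

lemma not_dense_subgroup_separable:
  assumes "uncountable (carrier D)"
  shows "\<not> dense_subgroup_separable G T"
proof -
  obtain I where I: "independent_in D I" "uncountable I"
    by (rule dual.uncountable_independent_set[OF assms])
  have Ic: "I \<subseteq> carrier D" and one_I: "\<one>\<^bsub>D\<^esub> \<notin> I"
    using I by (simp_all add: independent_in_def)
  define supp where "supp = (\<lambda>x. {\<kappa> \<in> I. \<kappa> x \<noteq> 1})"
  define H where "H = {x \<in> carrier G. countable (supp x)}"
  have H: "subgroup H G"
  proof
    show "H \<subseteq> carrier G" by (auto simp: H_def)
    show "\<one> \<in> H"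
    proof -
      have "supp \<one> = {}" using Ic character_one by (auto simp: supp_def)
      then show ?thesis by (simp add: H_def)
    qed
    show "x \<otimes> y \<in> H" if "x \<in> H" "y \<in> H" for x y
    proof -
      have c: "x \<in> carrier G" "y \<in> carrier G" using that by (auto simp: H_def)
      have "supp (x \<otimes> y) \<subseteq> supp x \<union> supp y"
        using Ic c by (auto simp: supp_def character_mult subset_iff)
      moreover have "countable (supp x \<union> supp y)" using that by (simp add: H_def)
      ultimately show ?thesis using c by (simp add: H_def countable_subset)
    qed
    show "inv x \<in> H" if "x \<in> H" for x
    proof -
      have c: "x \<in> carrier G" using that by (auto simp: H_def)
      have "supp (inv x) \<subseteq> supp x"
        using Ic c by (auto simp: supp_def character_inv subset_iff)
      then show ?thesis using c that by (simp add: H_def countable_subset)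
    qed
  qed
  have dense: "dense_in T H"
  proof -
    have "x \<in> T closure_of H" if x: "x \<in> carrier G" for x
    proof (rule ccontr)
      assume "x \<notin> T closure_of H"
      then obtain \<psi> where \<psi>: "\<psi> \<in> carrier D" "\<And>h. h \<in> H \<Longrightarrow> \<psi> h = 1" "\<psi> x \<noteq> 1"
        using separating_character[OF H x] by metis
      have gen: "\<psi> \<in> generate D (I - A)" if A: "countable A" for A
      proof (rule double_annihilator)
        show "I - A \<subseteq> carrier D" using Ic by blast
        show "\<psi> \<in> carrier D" by (rule \<psi>(1))
        fix y assume y: "y \<in> carrier G" "\<And>\<gamma>. \<gamma> \<in> I - A \<Longrightarrow> \<gamma> y = 1"
        have "supp y \<subseteq> A" using y(2) by (auto simp: supp_def)
        then have "y \<in> H" using y(1) A by (simp add: H_def countable_subset)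
        then show "\<psi> y = 1" by (rule \<psi>(2))
      qed
      have "\<psi> \<in> generate D I" using gen[of "{}"] by simp
      then obtain A where A: "A \<subseteq> I" "finite A" "\<psi> \<in> generate D A"
        using dual.generate_finite_support by blast
      have "generate D A \<inter> generate D (I - A) \<subseteq> {\<one>\<^bsub>D\<^esub>}"
        using I(1) A(1) by (simp add: independent_in_def)
      then have "\<psi> = \<one>\<^bsub>D\<^esub>" using A gen[of A] by (auto simp: countable_finite)
      then show False using \<psi>(3) x by simp
    qed
    then show ?thesis
      using subgroup.subset[OF H] closure_of_subset_topspace[of T H]
      by (auto simp: dense_in_def topspace_eq)
  qed
  have "\<not> separable_space (subtopology T H)"
  proof
    assume "separable_space (subtopology T H)"
    then obtain C where C: "countable C" "C \<subseteq> H" "subtopology T H closure_of C = H"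
      using subgroup.subset[OF H] by (auto simp: separable_space_def topspace_eq Int_absorb1)
    have "countable (\<Union>c\<in>C. supp c)" using C by (intro countable_UN) (auto simp: H_def)
    then obtain \<kappa> where \<kappa>: "\<kappa> \<in> I" "\<kappa> \<notin> (\<Union>c\<in>C. supp c)"
      using I(2) by (meson countable_subset subsetI)
    have \<kappa>D: "\<kappa> \<in> carrier D" using \<kappa> Ic by blast
    define K where "K = {x \<in> topspace T. \<kappa> x \<in> {1}}"
    have K: "closedin T K" unfolding K_def
      by (rule closedin_continuous_map_preimage[OF character_continuous[OF \<kappa>D]]) simp
    have "C \<subseteq> K"
      using \<kappa> C(2) by (auto simp: K_def supp_def topspace_eq H_def)
    then have "T closure_of C \<subseteq> K" using K by (rule closure_of_minimal)
    moreover have "H \<subseteq> T closure_of C"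
      using C(3) by (metis closure_of_subtopology_subset)
    ultimately have "T closure_of H \<subseteq> K" using K by (intro closure_of_minimal) auto
    then have "\<kappa> x = \<one>\<^bsub>D\<^esub> x" if "x \<in> carrier G" for x
      using dense that by (auto simp: dense_in_def K_def topspace_eq)
    then have "\<kappa> = \<one>\<^bsub>D\<^esub>" by (rule dual_eqI[OF \<kappa>D dual.one_closed])
    then show False using \<kappa>(1) one_I by simp
  qed
  then show ?thesis using H dense by (auto simp: dense_subgroup_separable_def)
qed

text \<open>
  The characters separate points, so evaluating all of them embeds a compact group into a product of
  circles indexed by the dual group. Repetitions in the enumeration of a finite dual are harmless.
\<close>

lemma embedding_into_torus:
  assumes "countable (carrier D)"
  shows "\<exists>H. subgroup H torus_group \<and>
    topologically_isomorphic G T (torus_group\<lparr>carrier := H\<rparr>) (subtopology torus_topology H)"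
proof -
  define e where "e = from_nat_into (carrier D)"
  have ne: "carrier D \<noteq> {}" using dual.one_closed by blast
  have e: "e n \<in> carrier D" for n unfolding e_def by (rule from_nat_into[OF ne])
  have onto: "\<exists>n. e n = \<kappa>" if "\<kappa> \<in> carrier D" for \<kappa>
    using range_from_nat_into[OF ne assms] that unfolding e_def by (metis imageE)
  define f where "f = (\<lambda>x n. e n x)"
  have inj: "inj_on f (carrier G)"
  proof (rule inj_onI, rule ccontr)
    fix x y assume xy: "x \<in> carrier G" "y \<in> carrier G" "f x = f y" "x \<noteq> y"
    have "T closure_of {\<one>} = {\<one>}"
      using Hausdorff by (simp add: closure_of_closedin closedin_Hausdorff_sing_eq topspace_eq)
    moreover have "inv y \<otimes> x \<noteq> \<one>"
      using xy by (metis inv_closed inv_equality inv_inv)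
    ultimately obtain \<kappa> where \<kappa>: "\<kappa> \<in> carrier D" "\<kappa> (inv y \<otimes> x) \<noteq> 1"
      using separating_character[OF triv_subgroup, of "inv y \<otimes> x"] xy by auto
    obtain n where "e n = \<kappa>" using onto[OF \<kappa>(1)] by blast
    then have "\<kappa> x = \<kappa> y" using fun_cong[OF xy(3), of n] by (simp add: f_def)
    then have "\<kappa> (inv y \<otimes> x) = 1"
      using \<kappa>(1) xy by (simp add: character_mult character_inv cnj_character_cancel)
    then show False using \<kappa>(2) by simp
  qed
  have f_hom: "f \<in> hom G torus_group"
    using e by (auto simp: hom_def f_def torus_group_def circle_group_def norm_character character_mult)
  have group_torus: "group torus_group"
    unfolding torus_group_def using comm_group_circle_group by (intro product_group) (simp add: comm_group_def)
  define H where "H = f ` carrier G"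
  have H: "subgroup H torus_group"
    unfolding H_def
    using group_hom.img_is_subgroup[of G torus_group f] f_hom group_torus is_group
    by (simp add: group_hom_def group_hom_axioms_def)
  have top_H: "topspace (subtopology torus_topology H) = H"
    using hom_carrier[OF f_hom]
    by (auto simp: H_def torus_topology_def torus_group_def circle_topology_def circle_group_def)
  have cont: "continuous_map T torus_topology f"
    unfolding torus_topology_def continuous_map_componentwise_UNIV
    using e by (auto simp: f_def dual_group_def)
  have "homeomorphic_map T (subtopology torus_topology H) f"
  proof (rule continuous_imp_homeomorphic_map)
    show "continuous_map T (subtopology torus_topology H) f"
      using cont by (auto simp: continuous_map_in_subtopology H_def topspace_eq)
    show "compact_space T" by (rule compact)
    show "Hausdorff_space (subtopology torus_topology H)"
      unfolding torus_topology_def circle_topology_def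
      by (intro Hausdorff_space_subtopology) (simp add: Hausdorff_space_product_topology Hausdorff_space_subtopology)
    show "f ` topspace T = topspace (subtopology torus_topology H)"
      by (simp only: top_H) (simp add: H_def topspace_eq)
    show "inj_on f (topspace T)" using inj by (simp add: topspace_eq)
  qed
  moreover have "f \<in> iso G (torus_group\<lparr>carrier := H\<rparr>)"
    using f_hom inj by (auto simp: iso_def hom_def bij_betw_def H_def)
  ultimately show ?thesis using H by (auto simp: topologically_isomorphic_def)
qed

end

lemma second_countable_euclidean:
  "second_countable (euclidean :: 'a::second_countable_topology topology)"
proof -
  obtain \<B> :: "'a set set" where "countable \<B>" "topological_basis \<B>"
    using ex_countable_basis by blast
  then show ?thesis
    unfolding second_countable_def
    by (intro exI[of _ \<B>]) (auto simp: topological_basis_open elim!: topological_basisE)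
qed

lemma second_countable_torus: "second_countable torus_topology"
  unfolding torus_topology_def circle_topology_def subtopology_product_topology[symmetric]
  by (simp add: euclidean_product_topology second_countable_subtopology second_countable_euclidean)

lemma dense_separable_if_second_countable:
  "second_countable T \<Longrightarrow> dense_separable T"
  by (simp add: dense_separable_def second_countable_imp_separable_space second_countable_subtopology)

theorem corollary3p10:
  fixes G :: "('a, 'b) monoid_scheme" and T :: "'a topology"
  assumes "topological_group G T" and "comm_group G"
    and "compact_space T" and "Hausdorff_space T"
    and "torsion_group G \<or> divisible_group G \<or> torsion_free_group G"
  shows "(dense_subgroup_separable G T \<longleftrightarrow> dense_separable T)
    \<and> (dense_separable T \<longleftrightarrow> countable (topspace (dual_topology G T)))
    \<and> (countable (topspace (dual_topology G T)) \<longleftrightarrow>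
        (\<exists>H. subgroup H torus_group \<and>
          topologically_isomorphic G T
            (torus_group\<lparr>carrier := H\<rparr>) (subtopology torus_topology H)))"
proof -
  interpret compact_abelian_group G T
    using assms(1-4) by (simp add: compact_abelian_group_def compact_abelian_group_axioms_def)
  let ?embeds = "\<exists>H. subgroup H torus_group \<and>
    topologically_isomorphic G T (torus_group\<lparr>carrier := H\<rparr>) (subtopology torus_topology H)"
  have 1: "countable (carrier D)" if "dense_subgroup_separable G T"
    using not_dense_subgroup_separable that by blast
  have 2: "?embeds" if "countable (carrier D)"
    by (rule embedding_into_torus[OF that])
  have "dense_separable T"
    if iso: "topologically_isomorphic G T (torus_group\<lparr>carrier := H\<rparr>) (subtopology torus_topology H)" for H
  proof (rule dense_separable_if_second_countable)
    obtain f where "homeomorphic_map T (subtopology torus_topology H) f"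
      using iso by (auto simp: topologically_isomorphic_def)
    then have "T homeomorphic_space subtopology torus_topology H"
      by (rule homeomorphic_map_imp_homeomorphic_space)
    then show "second_countable T"
      using homeomorphic_space_second_countability second_countable_torus second_countable_subtopology by blast
  qed
  then have 3: "dense_separable T" if ?embeds
    using that by (elim exE conjE)
  have 4: "dense_subgroup_separable G T" if "dense_separable T"
    using that by (simp add: dense_separable_def dense_subgroup_separable_def)
  show ?thesis
    unfolding topspace_dual_topology using 1 2 3 4 by argo
qed

end
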